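(* Let $d\ge 1$ be an integer and $\beta \in (0,d]$. For each $\alpha \in (d-\beta,d)$ and each $C'>0$ there exists a constant $C=C(\alpha,\beta,d,C')>0$ such that $$\left\|I_\alpha \mu \right\|_{L^1(\nu)} \leq C \|\mu\|_{DS_\beta(\mathbb{R}^d)}$$ for all (nonnegative) Radon measures $\nu$ on $\mathbb{R}^d$ such that $\nu(B(x,r))\leq C'r^{d-\alpha}$ for every ball $B(x,r)\subset\mathbb{R}^d$, and all $\mu \in DS_\beta(\mathbb{R}^d)$.
   Context: $M_b(\mathbb{R}^d)$ is the space of finite (signed) Radon measures on $\mathbb{R}^d$; $|\mu|$ denotes total variation. $e^{t\Delta}$, $t>0$, is the heat semigroup: $e^{t\Delta}\mu(x)=\int_{\mathbb{R}^d}(4\pi t)^{-d/2}e^{-|x-y|^2/4t}\,d\mu(y)$. Riesz potential: for $\alpha\in(0,d)$, $I_\alpha \mu$ is defined pointwise by $I_\alpha \mu(x):= \frac{1}{\Gamma(\alpha/2)} \int_0^\infty t^{\alpha/2-1} e^{t\Delta} \mu(x) \,dt \equiv \frac{1}{\gamma(\alpha)} \int_{\mathbb{R}^d} \frac{d\mu(y)}{|x-y|^{d-\alpha}}$, with $\gamma(\alpha)$ the corresponding normalization constant. $\beta$-atom ($\beta\in(0,d]$): a measure $a\in M_b(\mathbb{R}^d)$ for which there is a cube $Q\subset\mathbb{R}^d$ with sides parallel to the coordinate axes, of side length $l(Q)$, such that (1) $\operatorname{supp} a\subset Q$; (2) $a(Q)=0$; (3) $\sup_{x\in\mathbb{R}^d,\,t>0}|t^{(d-\beta)/2}e^{t\Delta}a(x)|\le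 l(Q)^{-\beta}$; (4) $|a|(\mathbb{R}^d)\le 1$. $DS_\beta(\mathbb{R}^d)$ is the set of $\mu\in M_b(\mathbb{R}^d)$ for which there are scalars $\lambda_{i,n}$ and $\beta$-atoms $a_{i,n}$ ($1\le i\le n$, $n\in\mathbb{N}$) with $\limsup_{n\to\infty}\sum_{i=1}^n|\lambda_{i,n}|<+\infty$ and $\mu=\lim_{n\to\infty}\sum_{i=1}^n\lambda_{i,n}a_{i,n}$ weakly-star as measures, i.e. $\int\varphi\,d\mu=\lim_{n\to\infty}\sum_{i=1}^n\lambda_{i,n}\int\varphi\,da_{i,n}$ for all $\varphi\in C_0(\mathbb{R}^d)$. Its norm $\|\mu\|_{DS_\beta(\mathbb{R}^d)}$ is the infimum of $\limsup_{n\to\infty}\sum_{i=1}^n|\lambda_{i,n}|$ over all such representations of $\mu$. *)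

theory Defs
  imports "HOL-Analysis.Analysis"
begin

text \<open>A finite signed Borel measure is a real-valued set function that is countably additive
  on the Borel sets; its values on other sets are irrelevant. On \<open>real ^ 'd\<close> every such
  set function is Radon and has finite total variation.\<close>

definition finite_signed_measure :: "('a::topological_space set \<Rightarrow> real) \<Rightarrow> bool" where
  "finite_signed_measure \<mu> \<longleftrightarrow>
    (\<forall>A :: nat \<Rightarrow> 'a set. range A \<subseteq> sets borel \<longrightarrow> disjoint_family A \<longrightarrow>
       (\<lambda>i. \<mu> (A i)) sums \<mu> (\<Union>i. A i))"

text \<open>Jordan decomposition. The truncation of negative reals to 0 by \<open>ennreal\<close> is harmless,
  since \<open>B = {}\<close> always contributes 0 to the supremum.\<close>

definition upper_variation :: "('a::topological_space set \<Rightarrow> real) \<Rightarrow> 'a measure" where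
  "upper_variation \<mu> =
    measure_of UNIV (sets borel) (\<lambda>A. SUP B \<in> {B \<in> sets borel. B \<subseteq> A}. ennreal (\<mu> B))"

definition lower_variation :: "('a::topological_space set \<Rightarrow> real) \<Rightarrow> 'a measure" where
  "lower_variation \<mu> = upper_variation (\<lambda>A. - \<mu> A)"

definition total_variation :: "('a::topological_space set \<Rightarrow> real) \<Rightarrow> 'a set \<Rightarrow> ennreal" where
  "total_variation \<mu> A = emeasure (upper_variation \<mu>) A + emeasure (lower_variation \<mu>) A"

definition signed_integral :: "('a::topological_space set \<Rightarrow> real) \<Rightarrow> ('a \<Rightarrow> real) \<Rightarrow> real" where
  "signed_integral \<mu> f =
    (LINT x|upper_variation \<mu>. f x) - (LINT x|lower_variation \<mu>. f x)"

definition signed_support :: "('a::topological_space set \<Rightarrow> real) \<Rightarrow> 'a set" where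
  "signed_support \<mu> = {x. \<forall>U. open U \<and> x \<in> U \<longrightarrow> total_variation \<mu> U > 0}"

text \<open>Regularity is automatic for locally finite Borel measures on \<open>real ^ 'd\<close>.\<close>

definition radon_measure :: "(real ^ 'd) measure \<Rightarrow> bool" where
  "radon_measure \<nu> \<longleftrightarrow> sets \<nu> = sets borel \<and> (\<forall>K. compact K \<longrightarrow> emeasure \<nu> K < \<infinity>)"

definition heat :: "real \<Rightarrow> ((real ^ 'd) set \<Rightarrow> real) \<Rightarrow> real ^ 'd \<Rightarrow> real" where
  "heat t \<mu> x =
    signed_integral \<mu>
      (\<lambda>y. (4 * pi * t) powr (- real CARD('d) / 2) * exp (- (norm (x - y))\<^sup>2 / (4 * t)))"

text \<open>The Riesz potential at \<open>x\<close> is meaningful only where the time integral converges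
  absolutely; elsewhere the Lebesgue integral defaults to 0.\<close>

definition riesz_converges :: "real \<Rightarrow> ((real ^ 'd) set \<Rightarrow> real) \<Rightarrow> real ^ 'd \<Rightarrow> bool" where
  "riesz_converges \<alpha> \<mu> x \<longleftrightarrow>
    set_integrable lborel {0<..} (\<lambda>t. t powr (\<alpha> / 2 - 1) * heat t \<mu> x)"

definition riesz_potential :: "real \<Rightarrow> ((real ^ 'd) set \<Rightarrow> real) \<Rightarrow> real ^ 'd \<Rightarrow> real" where
  "riesz_potential \<alpha> \<mu> x =
    1 / Gamma (\<alpha> / 2) * (LINT t:{0<..}|lborel. t powr (\<alpha> / 2 - 1) * heat t \<mu> x)"

definition is_atom :: "real \<Rightarrow> ((real ^ 'd) set \<Rightarrow> real) \<Rightarrow> bool" where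
  "is_atom \<beta> a \<longleftrightarrow> finite_signed_measure a \<and>
    (\<exists>c l Q. l > 0 \<and> Q = cbox c (\<chi> i. c $ i + l) \<and>
       signed_support a \<subseteq> Q \<and>
       a Q = 0 \<and>
       (\<forall>x t. t > 0 \<longrightarrow> \<bar>t powr ((real CARD('d) - \<beta>) / 2) * heat t a x\<bar> \<le> l powr (- \<beta>)) \<and>
       total_variation a UNIV \<le> 1)"

definition coeff_size :: "(nat \<Rightarrow> nat \<Rightarrow> real) \<Rightarrow> ereal" where
  "coeff_size c = limsup (\<lambda>n. ereal (\<Sum>i=1..n. \<bar>c i n\<bar>))"

definition atomic_representation ::
    "real \<Rightarrow> ((real ^ 'd) set \<Rightarrow> real) \<Rightarrow> (nat \<Rightarrow> nat \<Rightarrow> real) \<Rightarrow>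
     (nat \<Rightarrow> nat \<Rightarrow> (real ^ 'd) set \<Rightarrow> real) \<Rightarrow> bool" where
  "atomic_representation \<beta> \<mu> c a \<longleftrightarrow>
    (\<forall>n. \<forall>i\<in>{1..n}. is_atom \<beta> (a i n)) \<and>
    coeff_size c < \<infinity> \<and>
    (\<forall>\<phi> :: real ^ 'd \<Rightarrow> real. continuous_on UNIV \<phi> \<and> (\<phi> \<longlongrightarrow> 0) at_infinity \<longrightarrow>
       (\<lambda>n. \<Sum>i=1..n. c i n * signed_integral (a i n) \<phi>) \<longlonglongrightarrow> signed_integral \<mu> \<phi>)"

definition DS :: "real \<Rightarrow> ((real ^ 'd) set \<Rightarrow> real) set" where
  "DS \<beta> = {\<mu>. finite_signed_measure \<mu> \<and> (\<exists>c a. atomic_representation \<beta> \<mu> c a)}"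

definition DS_norm :: "real \<Rightarrow> ((real ^ 'd) set \<Rightarrow> real) \<Rightarrow> ereal" where
  "DS_norm \<beta> \<mu> = Inf {coeff_size c | c a. atomic_representation \<beta> \<mu> c a}"

end

theory Submission
  imports Defs
begin

text \<open>The estimate is first proved for a single atom \<open>a\<close>, in a form stronger than the claim: the
  double integral of \<open>t powr (\<alpha> / 2 - 1) * \<bar>heat t a x\<bar>\<close> over \<open>t > 0\<close> and over \<open>x\<close> with respect
  to \<open>\<nu>\<close> is at most a constant \<open>K\<close> independent of \<open>a\<close> and of \<open>\<nu>\<close> (\<open>heat_mass_atom_bounded\<close>).
  The order of integration is exchanged, so that for each time \<open>t\<close> the heat extension is
  integrated against \<open>\<nu>\<close>. Write
  \<open>d\<close> for the dimension, \<open>l\<close> for the side of the cube of \<open>a\<close> and \<open>c\<close> for one of its corners. The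
  growth condition on \<open>\<nu>\<close> gives a Gaussian of width \<open>sqrt t\<close> an integral of order
  \<open>t powr ((d - \<alpha>) / 2)\<close> (\<open>nn_integral_gaussian_le\<close>). There are three regimes.

  \<^item> For \<open>t \<le> l\<^sup>2\<close> and \<open>x\<close> within distance of order \<open>l\<close> from \<open>c\<close>, the size condition
    \<open>\<bar>heat t a x\<bar> \<le> l powr (- \<beta>) * t powr (- ((d - \<beta>) / 2))\<close> is used. The resulting power of \<open>t\<close> is
    integrable at \<open>0\<close> exactly because \<open>d - \<beta> < \<alpha>\<close>.
  \<^item> For \<open>t \<le> l\<^sup>2\<close> and \<open>x\<close> further away, the heat kernel centred at \<open>x\<close> is exponentially
    small in \<open>l\<^sup>2 / t\<close> on the cube.
  \<^item> For \<open>t > l\<^sup>2\<close>, the vanishing total mass of \<open>a\<close> permits the heat kernel to be replaced by its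
    difference with its value at \<open>c\<close>, which gains a factor \<open>l / sqrt t\<close> and makes the time
    integral converge at infinity.

  Each regime contributes a bound in which all powers of \<open>l\<close> cancel.

  The passage to a general \<open>\<mu>\<close> is soft. For fixed \<open>x\<close> and \<open>t > 0\<close> the heat kernel is a function
  in \<open>C\<^sub>0\<close>, so weak-star convergence of the atomic sums gives pointwise convergence
  of their heat extensions, and Fatou's lemma bounds the double integral for \<open>\<mu>\<close> by \<open>K\<close> times the
  limsup of the coefficient sums (\<open>heat_mass_representation\<close>). Finiteness of the double integral
  gives absolute convergence of the Riesz potential at \<open>\<nu>\<close>-almost every point, and the
  \<open>L\<^sup>1\<close> bound follows on dividing by \<open>Gamma (\<alpha> / 2)\<close>
  (\<open>riesz_potential_of_heat_mass\<close>).\<close>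

section \<open>Jordan decomposition of a signed measure\<close>

lemma finite_signed_measure_empty:
  assumes "finite_signed_measure \<mu>"
  shows "\<mu> {} = 0"
proof -
  have "(\<lambda>i::nat. \<mu> {}) sums \<mu> (\<Union>i::nat. {})"
    using assms unfolding finite_signed_measure_def
    by (elim allE[of _ "\<lambda>_. {}"]) (auto simp: disjoint_family_on_def)
  then have "(\<lambda>i::nat. \<mu> {}) \<longlonglongrightarrow> 0"
    using sums_summable summable_LIMSEQ_zero by blast
  then show ?thesis
    using LIMSEQ_unique tendsto_const by blast
qed

lemma finite_signed_measure_Un:
  assumes \<mu>: "finite_signed_measure \<mu>"
    and A: "A \<in> sets borel" and B: "B \<in> sets borel" and AB: "A \<inter> B = {}"
  shows "\<mu> (A \<union> B) = \<mu> A + \<mu> B"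
proof -
  have "(\<lambda>i. \<mu> (binaryset A B i)) sums \<mu> (\<Union>i. binaryset A B i)"
    using \<mu> A B AB unfolding finite_signed_measure_def
    by (elim allE[of _ "binaryset A B"])
       (auto simp: disjoint_family_on_def range_binaryset_eq binaryset_def split: if_splits)
  moreover have "(\<lambda>i. \<mu> (binaryset A B i)) sums (\<mu> A + \<mu> B)"
    by (rule binaryset_sums) (rule finite_signed_measure_empty[OF \<mu>])
  ultimately show ?thesis
    using sums_unique2 by (metis UN_binaryset_eq)
qed

lemma finite_signed_measure_uminus:
  "finite_signed_measure \<mu> \<Longrightarrow> finite_signed_measure (\<lambda>A. - \<mu> A)"
  unfolding finite_signed_measure_def using sums_minus by blast

text \<open>The set function that generates \<^const>\<open>upper_variation\<close>. The Borel subsets of \<open>A\<close> over which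
  the supremum is taken are called the competitors for \<open>A\<close> below.\<close>
definition positive_part :: "('a::topological_space set \<Rightarrow> real) \<Rightarrow> 'a set \<Rightarrow> ennreal" where
  "positive_part \<mu> A = (SUP B \<in> {B \<in> sets borel. B \<subseteq> A}. ennreal (\<mu> B))"

lemma positive_part_upper:
  "B \<in> sets borel \<Longrightarrow> B \<subseteq> A \<Longrightarrow> ennreal (\<mu> B) \<le> positive_part \<mu> A"
  unfolding positive_part_def by (rule SUP_upper) simp

lemma positive_part_mono: "A \<subseteq> B \<Longrightarrow> positive_part \<mu> A \<le> positive_part \<mu> B"
  unfolding positive_part_def by (rule SUP_subset_mono) auto

text \<open>The union of a competitor for \<open>A\<close> and a competitor for \<open>B\<close> is a competitor for \<open>A \<union> B\<close>.
  Truncation does no harm: a competitor of negative measure is replaced by the empty set.\<close>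
lemma positive_part_superadditive:
  assumes \<mu>: "finite_signed_measure \<mu>" and disj: "A \<inter> B = {}"
  shows "positive_part \<mu> A + positive_part \<mu> B \<le> positive_part \<mu> (A \<union> B)"
proof -
  have *: "ennreal (\<mu> X) + ennreal (\<mu> Y) \<le> positive_part \<mu> (A \<union> B)"
    if X: "X \<in> sets borel" "X \<subseteq> A" and Y: "Y \<in> sets borel" "Y \<subseteq> B" for X Y
  proof (cases "0 \<le> \<mu> X \<and> 0 \<le> \<mu> Y")
    case True
    have "X \<inter> Y = {}"
      using X Y disj by blast
    with True have "ennreal (\<mu> X) + ennreal (\<mu> Y) = ennreal (\<mu> (X \<union> Y))"
      by (simp add: finite_signed_measure_Un[OF \<mu> X(1) Y(1)])
    also have "\<dots> \<le> positive_part \<mu> (A \<union> B)"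
      using X Y by (intro positive_part_upper) auto
    finally show ?thesis .
  next
    case False
    then have "ennreal (\<mu> X) = 0 \<or> ennreal (\<mu> Y) = 0"
      by (auto simp: ennreal_neg)
    then show ?thesis
      using positive_part_upper[OF X(1), of "A \<union> B" \<mu>] positive_part_upper[OF Y(1), of "A \<union> B" \<mu>]
        X(2) Y(2) by (auto simp: le_supI1 le_supI2)
  qed
  have ne: "{X \<in> sets borel. X \<subseteq> Z} \<noteq> {}" for Z :: "'a set"
    by auto
  have "positive_part \<mu> A + positive_part \<mu> B
      = (SUP X \<in> {X \<in> sets borel. X \<subseteq> A}. ennreal (\<mu> X) + positive_part \<mu> B)"
    unfolding positive_part_def[of \<mu> A] by (rule ennreal_SUP_add_left[symmetric, OF ne])
  also have "\<dots> \<le> positive_part \<mu> (A \<union> B)"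
  proof (rule SUP_least)
    fix X assume X: "X \<in> {X \<in> sets borel. X \<subseteq> A}"
    have "ennreal (\<mu> X) + positive_part \<mu> B
        = (SUP Y \<in> {Y \<in> sets borel. Y \<subseteq> B}. ennreal (\<mu> Y) + ennreal (\<mu> X))"
      unfolding positive_part_def[of \<mu> B]
      by (subst ennreal_SUP_add_left[OF ne]) (rule add.commute)
    also have "\<dots> \<le> positive_part \<mu> (A \<union> B)"
      by (rule SUP_least) (subst add.commute, use X * in blast)
    finally show "ennreal (\<mu> X) + positive_part \<mu> B \<le> positive_part \<mu> (A \<union> B)" .
  qed
  finally show ?thesis .
qed

lemma positive_part_empty: "finite_signed_measure \<mu> \<Longrightarrow> positive_part \<mu> {} = 0"
  unfolding positive_part_def by (simp add: finite_signed_measure_empty)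

lemma ennreal_sum_le: "ennreal (sum f I) \<le> (\<Sum>i\<in>I. ennreal (f i))"
proof -
  have "ennreal (sum f I) \<le> ennreal (\<Sum>i\<in>I. max 0 (f i))"
    by (intro ennreal_leI sum_mono) simp
  also have "\<dots> = (\<Sum>i\<in>I. ennreal (max 0 (f i)))"
    by (rule sum_ennreal[symmetric]) simp
  also have "\<dots> = (\<Sum>i\<in>I. ennreal (f i))"
    by (intro sum.cong) (auto simp: max_def ennreal_neg)
  finally show ?thesis .
qed

text \<open>One inequality is the limit of finite superadditivity. For the other one, every competitor
  for the union is cut along the sets \<open>A i\<close>. This makes \<^const>\<open>upper_variation\<close> a genuine
  measure given by the supremum, without a Hahn decomposition.\<close>
lemma countably_additive_positive_part:
  assumes \<mu>: "finite_signed_measure \<mu>"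
  shows "countably_additive (sets borel) (positive_part \<mu>)"
  unfolding countably_additive_def
proof (intro allI impI antisym)
  fix A :: "nat \<Rightarrow> 'a set"
  assume A: "range A \<subseteq> sets borel" and disj: "disjoint_family A"
  show "(\<Sum>i. positive_part \<mu> (A i)) \<le> positive_part \<mu> (\<Union>i. A i)"
  proof -
    have "(\<Sum>i<n. positive_part \<mu> (A i)) \<le> positive_part \<mu> (\<Union>i<n. A i)" for n
    proof (induction n)
      case (Suc n)
      have "(\<Union>i<n. A i) \<inter> A n = {}"
        using disj by (auto simp: disjoint_family_on_def disjoint_iff) (metis nat_neq_iff)
      then have "positive_part \<mu> (\<Union>i<n. A i) + positive_part \<mu> (A n)
          \<le> positive_part \<mu> ((\<Union>i<n. A i) \<union> A n)"
        by (rule positive_part_superadditive[OF \<mu>])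
      moreover have "(\<Union>i<n. A i) \<union> A n = (\<Union>i<Suc n. A i)"
        by (auto simp: lessThan_Suc)
      ultimately have "positive_part \<mu> (\<Union>i<n. A i) + positive_part \<mu> (A n)
          \<le> positive_part \<mu> (\<Union>i<Suc n. A i)"
        by metis
      then show ?case
        unfolding sum.lessThan_Suc by (rule order_trans[OF add_right_mono[OF Suc]])
    qed simp
    also have "positive_part \<mu> (\<Union>i<n. A i) \<le> positive_part \<mu> (\<Union>i. A i)" for n
      by (rule positive_part_mono) auto
    finally show ?thesis
      using ennreal_suminf_bound_add[of "\<lambda>i. positive_part \<mu> (A i)" 0] by simp
  qed
  show "positive_part \<mu> (\<Union>i. A i) \<le> (\<Sum>i. positive_part \<mu> (A i))"
    unfolding positive_part_def[of \<mu> "\<Union>i. A i"]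
  proof (rule SUP_least, clarify)
    fix B :: "'a set" assume B: "B \<in> sets borel" "B \<subseteq> (\<Union>i. A i)"
    have "(\<lambda>i. \<mu> (B \<inter> A i)) sums \<mu> (\<Union>i. B \<inter> A i)"
      using \<mu> A B disj unfolding finite_signed_measure_def
      by (elim allE[of _ "\<lambda>i. B \<inter> A i"]) (auto simp: disjoint_family_on_def disjoint_iff)
    moreover have "(\<Union>i. B \<inter> A i) = B"
      using B(2) by auto
    ultimately have lim: "(\<lambda>n. ennreal (\<Sum>i<n. \<mu> (B \<inter> A i))) \<longlonglongrightarrow> ennreal (\<mu> B)"
      by (auto simp: sums_def)
    have "ennreal (\<Sum>i<n. \<mu> (B \<inter> A i)) \<le> (\<Sum>i. positive_part \<mu> (A i))" for n
    proof -
      have "ennreal (\<Sum>i<n. \<mu> (B \<inter> A i)) \<le> (\<Sum>i<n. ennreal (\<mu> (B \<inter> A i)))"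
        by (rule ennreal_sum_le)
      also have "\<dots> \<le> (\<Sum>i<n. positive_part \<mu> (A i))"
        using A B by (intro sum_mono positive_part_upper) auto
      also have "\<dots> \<le> (\<Sum>i. positive_part \<mu> (A i))"
        by (rule sum_le_suminf) auto
      finally show ?thesis .
    qed
    then show "ennreal (\<mu> B) \<le> (\<Sum>i. positive_part \<mu> (A i))"
      by (intro LIMSEQ_le_const2[OF lim]) auto
  qed
qed

lemma sets_upper_variation [simp, measurable_cong]: "sets (upper_variation \<mu>) = sets borel"
  unfolding upper_variation_def
  using sets.sigma_sets_eq[of borel] by (simp add: sets_measure_of)

lemma space_upper_variation [simp]: "space (upper_variation \<mu>) = UNIV"
  by (metis sets_eq_imp_space_eq sets_upper_variation space_borel)

lemma sets_lower_variation [simp, measurable_cong]: "sets (lower_variation \<mu>) = sets borel"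
  unfolding lower_variation_def by simp

lemma space_lower_variation [simp]: "space (lower_variation \<mu>) = UNIV"
  unfolding lower_variation_def by simp

lemma emeasure_upper_variation:
  assumes "finite_signed_measure \<mu>" "A \<in> sets borel"
  shows "emeasure (upper_variation \<mu>) A = positive_part \<mu> A"
proof -
  have "sigma_algebra UNIV (sets borel :: 'a set set)"
    using sets.sigma_algebra_axioms[of borel] by simp
  then show ?thesis
    unfolding upper_variation_def positive_part_def[symmetric]
    using assms
    by (intro emeasure_measure_of_sigma countably_additive_positive_part)
       (auto simp: positive_def positive_part_empty)
qed

text \<open>If \<open>B\<close> is a competitor for the upper variation of \<open>A\<close>, then \<open>A - B\<close> is one for the lower
  variation, and \<open>\<mu> B = \<mu> A - \<mu> (A - B)\<close>.\<close>
lemma upper_variation_le_lower_variation_plus: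
  assumes \<mu>: "finite_signed_measure \<mu>" and A: "A \<in> sets borel"
  shows "emeasure (upper_variation \<mu>) A \<le> emeasure (lower_variation \<mu>) A + ennreal (\<mu> A)"
proof -
  have "ennreal (\<mu> B) \<le> positive_part (\<lambda>A. - \<mu> A) A + ennreal (\<mu> A)"
    if B: "B \<in> sets borel" "B \<subseteq> A" for B
  proof -
    have "\<mu> A = \<mu> B + \<mu> (A - B)"
      using finite_signed_measure_Un[OF \<mu> B(1), of "A - B"] A B by (simp add: Un_absorb1)
    then have "ennreal (\<mu> B) = ennreal (\<mu> A + - \<mu> (A - B))"
      by simp
    also have "\<dots> \<le> ennreal (\<mu> A) + ennreal (- \<mu> (A - B))"
      using ennreal_sum_le[of "\<lambda>b. if b then \<mu> A else - \<mu> (A - B)" UNIV]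
      by (simp add: UNIV_bool add.commute)
    also have "\<dots> \<le> ennreal (\<mu> A) + positive_part (\<lambda>A. - \<mu> A) A"
      using positive_part_upper[of "A - B" A "\<lambda>A. - \<mu> A"] A B by (intro add_left_mono) auto
    finally show ?thesis by (simp add: add.commute)
  qed
  then show ?thesis
    using emeasure_upper_variation[OF \<mu> A]
      emeasure_upper_variation[OF finite_signed_measure_uminus[OF \<mu>] A]
    unfolding lower_variation_def by (auto simp: positive_part_def[of \<mu>] intro: SUP_least)
qed

lemma upper_variation_eq_lower_variation_null:
  assumes \<mu>: "finite_signed_measure \<mu>" and A: "A \<in> sets borel" and "\<mu> A = 0"
  shows "emeasure (upper_variation \<mu>) A = emeasure (lower_variation \<mu>) A"
  using upper_variation_le_lower_variation_plus[OF \<mu> A]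
    upper_variation_le_lower_variation_plus[OF finite_signed_measure_uminus[OF \<mu>] A] \<open>\<mu> A = 0\<close>
  by (simp add: lower_variation_def)

text \<open>The complement of the support is a union of open null sets, and by the Lindelof property
  countably many of them suffice.\<close>
lemma total_variation_off_support:
  fixes \<mu> :: "'a::second_countable_topology set \<Rightarrow> real"
  assumes Q: "closed Q" and supp: "signed_support \<mu> \<subseteq> Q"
  shows "total_variation \<mu> (- Q) = 0"
proof -
  define \<F> where "\<F> = {U. open U \<and> total_variation \<mu> U = 0}"
  have cover: "- Q \<subseteq> \<Union>\<F>"
    using supp unfolding signed_support_def \<F>_def by (auto simp: zero_less_iff_neq_zero)
  obtain \<G> where \<G>: "\<G> \<subseteq> \<F>" "countable \<G>" "\<Union>\<G> = \<Union>\<F>"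
    using Lindelof[of \<F>] unfolding \<F>_def by blast
  have null: "U \<in> null_sets (upper_variation \<mu>) \<and> U \<in> null_sets (lower_variation \<mu>)" if "U \<in> \<G>" for U
    using that \<G>(1) by (auto simp: \<F>_def total_variation_def null_sets_def)
  have "\<Union>\<G> \<in> null_sets (upper_variation \<mu>)" "\<Union>\<G> \<in> null_sets (lower_variation \<mu>)"
    using null null_sets_UN'[OF \<G>(2), of "\<lambda>U. U"] by auto
  then have "- Q \<in> null_sets (upper_variation \<mu>)" "- Q \<in> null_sets (lower_variation \<mu>)"
    using cover Q \<G>(3) by (auto intro: null_sets_subset)
  then show ?thesis
    by (simp add: total_variation_def null_sets_def)
qed

section \<open>Heat extension of an atom\<close>

lemma finite_measure_variations:
  assumes "total_variation \<mu> UNIV < \<infinity>"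
  shows "finite_measure (upper_variation \<mu>)" "finite_measure (lower_variation \<mu>)"
  using assms by (auto intro!: finite_measureI simp: total_variation_def)

lemma abs_signed_integral_le:
  fixes f :: "'a::topological_space \<Rightarrow> real"
  assumes tv: "total_variation \<mu> UNIV \<le> 1" and off: "total_variation \<mu> (- Q) = 0"
    and Q: "Q \<in> sets borel" and f: "f \<in> borel_measurable borel"
    and le: "\<And>y. y \<in> Q \<Longrightarrow> \<bar>f y\<bar> \<le> M" and M: "0 \<le> M"
  shows "\<bar>signed_integral \<mu> f\<bar> \<le> M"
proof -
  have tv': "total_variation \<mu> UNIV < \<infinity>"
    using tv by (rule order_le_less_trans) simp
  interpret U: finite_measure "upper_variation \<mu>"
    by (rule finite_measure_variations[OF tv'])
  interpret L: finite_measure "lower_variation \<mu>"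
    by (rule finite_measure_variations[OF tv'])
  have *: "\<bar>LINT x|W. f x\<bar> \<le> M * measure W UNIV"
    if W: "finite_measure W" "sets W = sets borel" "emeasure W (- Q) = 0" for W
  proof -
    interpret W: finite_measure W by fact
    have sp: "space W = UNIV"
      using sets_eq_imp_space_eq[OF W(2)] by simp
    have ae: "AE y in W. \<bar>f y\<bar> \<le> M"
      using le W(2,3) Q sp by (intro AE_I[of _ _ "- Q"]) auto
    have fW: "f \<in> borel_measurable W"
      using f W(2) by (simp cong: measurable_cong_sets)
    have int: "integrable W f"
      using ae fW by (intro W.integrable_const_bound[of f M]) auto
    have "\<bar>LINT x|W. f x\<bar> \<le> (LINT x|W. \<bar>f x\<bar>)"
      using integral_norm_bound[of W f] by simp
    also have "\<dots> \<le> (LINT x|W. M)"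
      using int ae by (intro integral_mono_AE) auto
    finally show ?thesis by (simp add: sp mult.commute)
  qed
  have "ennreal (measure (upper_variation \<mu>) UNIV + measure (lower_variation \<mu>) UNIV)
      = total_variation \<mu> UNIV"
    unfolding total_variation_def by (simp add: U.emeasure_eq_measure L.emeasure_eq_measure)
  with tv have one: "measure (upper_variation \<mu>) UNIV + measure (lower_variation \<mu>) UNIV \<le> 1"
    by (metis ennreal_le_1)
  have "\<bar>signed_integral \<mu> f\<bar> \<le> M * measure (upper_variation \<mu>) UNIV + M * measure (lower_variation \<mu>) UNIV"
    using *[OF U.finite_measure_axioms] *[OF L.finite_measure_axioms] off
    unfolding signed_integral_def total_variation_def by fastforce
  also have "\<dots> \<le> M * 1"
    using mult_left_mono[OF one M] by (simp add: algebra_simps)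
  finally show ?thesis by simp
qed

text \<open>This is the cancellation of atoms: both variations have the same total mass, so constants
  integrate to zero.\<close>
lemma signed_integral_diff_const:
  fixes f :: "'a::topological_space \<Rightarrow> real"
  assumes tv: "total_variation \<mu> UNIV < \<infinity>"
    and bal: "emeasure (upper_variation \<mu>) UNIV = emeasure (lower_variation \<mu>) UNIV"
    and f: "f \<in> borel_measurable borel" and le: "\<And>y. \<bar>f y\<bar> \<le> M"
  shows "signed_integral \<mu> (\<lambda>y. f y - k) = signed_integral \<mu> f"
proof -
  interpret U: finite_measure "upper_variation \<mu>"
    by (rule finite_measure_variations[OF tv])
  interpret L: finite_measure "lower_variation \<mu>"
    by (rule finite_measure_variations[OF tv])
  have "integrable (upper_variation \<mu>) f" "integrable (lower_variation \<mu>) f"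
    using f le by (auto intro!: U.integrable_const_bound[of f M] L.integrable_const_bound[of f M]
        cong: measurable_cong_sets)
  then show ?thesis
    using bal by (simp add: signed_integral_def measure_def)
qed

definition heat_kernel :: "real \<Rightarrow> real ^ 'd \<Rightarrow> real" where
  "heat_kernel t z = (4 * pi * t) powr (- real CARD('d) / 2) * exp (- (norm z)\<^sup>2 / (4 * t))"

lemma heat_eq_signed_integral: "heat t \<mu> x = signed_integral \<mu> (\<lambda>y. heat_kernel t (x - y))"
  by (simp add: heat_def heat_kernel_def)

lemma continuous_heat_kernel: "continuous_on UNIV (\<lambda>y. heat_kernel t (x - y))"
  unfolding heat_kernel_def divide_inverse by (intro continuous_intros)

lemma measurable_heat_kernel [measurable]: "(\<lambda>y. heat_kernel t (x - y)) \<in> borel_measurable borel"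
  using continuous_heat_kernel by (rule borel_measurable_continuous_onI)

lemma heat_kernel_tendsto_0:
  assumes "0 < t"
  shows "((\<lambda>y. heat_kernel t (x - y)) \<longlongrightarrow> 0) at_infinity"
proof -
  have *: "((\<lambda>s. exp (- s\<^sup>2 / (4 * t))) \<longlongrightarrow> 0) at_top"
  proof -
    have "filterlim (\<lambda>s::real. s\<^sup>2 / (4 * t)) at_top at_top"
      using assms
      by (intro filterlim_at_top_mult_tendsto_pos[of "\<lambda>_. 1 / (4 * t)" "1 / (4 * t)" _ "\<lambda>s. s\<^sup>2", simplified]
          filterlim_pow_at_top filterlim_ident) auto
    then have "filterlim (\<lambda>s::real. - (s\<^sup>2 / (4 * t))) at_bot at_top"
      by (simp add: filterlim_uminus_at_top)
    then show ?thesis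
      using filterlim_compose[OF exp_at_bot] by simp
  qed
  have "filterlim (\<lambda>y. norm (x - y)) at_top at_infinity"
  proof (rule filterlim_at_top_mono)
    show "filterlim (\<lambda>y. - norm x + norm y) at_top at_infinity"
      by (rule filterlim_tendsto_add_at_top[OF tendsto_const filterlim_norm_at_top])
    show "\<forall>\<^sub>F y in at_infinity. - norm x + norm y \<le> norm (x - y)"
      by (rule always_eventually) (metis add.commute diff_conv_add_uminus norm_minus_commute norm_triangle_ineq2)
  qed
  from filterlim_compose[OF * this] show ?thesis
    unfolding heat_kernel_def by (intro tendsto_mult_right_zero)
qed

lemma abs_heat_kernel_le:
  fixes z :: "real ^ 'd"
  assumes "0 < t" shows "\<bar>heat_kernel t z\<bar> \<le> (4 * pi * t) powr (- real CARD('d) / 2)"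
  using assms by (simp add: heat_kernel_def mult_left_le)

text \<open>Mean value theorem for the Gaussian profile. Its derivative is at most \<open>1 / sqrt t\<close> times a
  Gaussian of twice the variance. At a point within distance \<open>D\<close> of \<open>v\<close> that Gaussian is
  recentred at \<open>v\<close> by \<open>v\<^sup>2 \<le> 2 * \<xi>\<^sup>2 + 2 * D\<^sup>2\<close>, at the price of a factor that is bounded as long
  as \<open>D\<close> is at most comparable to \<open>sqrt t\<close>.\<close>
lemma exp_neg_square_lipschitz:
  fixes u v D t :: real
  assumes t: "0 < t" and uv: "\<bar>u - v\<bar> \<le> D"
  shows "\<bar>exp (- u\<^sup>2 / (4 * t)) - exp (- v\<^sup>2 / (4 * t))\<bar>
    \<le> D / sqrt t * exp (D\<^sup>2 / (8 * t)) * exp (- v\<^sup>2 / (16 * t))"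
proof -
  define g' where "g' = (\<lambda>\<xi>. - (\<xi> / (2 * t)) * exp (- \<xi>\<^sup>2 / (4 * t)))"
  define B where "B = 1 / sqrt t * exp (D\<^sup>2 / (8 * t)) * exp (- v\<^sup>2 / (16 * t))"
  have deriv: "((\<lambda>\<xi>. exp (- \<xi>\<^sup>2 / (4 * t))) has_field_derivative g' \<xi>) (at \<xi> within cball v D)" for \<xi>
    unfolding g'_def using t by (auto intro!: derivative_eq_intros simp: field_simps)
  have bound: "norm (g' \<xi>) \<le> B" if \<xi>: "\<xi> \<in> cball v D" for \<xi>
  proof -
    define s where "s = \<bar>\<xi>\<bar> / sqrt t"
    have s2: "s\<^sup>2 = \<xi>\<^sup>2 / t"
      using t by (simp add: s_def power_divide)
    \<comment> \<open>Half of the exponent absorbs the linear factor; the constant comes from \<open>(s - 2)\<^sup>2 \<ge> 0\<close>.\<close>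
    have "s \<le> 2 * (1 + s\<^sup>2 / 8)"
      using zero_le_power2[of "s - 2"] by (simp add: power2_eq_square algebra_simps)
    also have "\<dots> \<le> 2 * exp (s\<^sup>2 / 8)"
      by (intro mult_left_mono exp_ge_add_one_self) simp
    finally have s: "s * exp (- (s\<^sup>2 / 8)) \<le> 2"
      by (simp add: exp_minus field_simps)
    have "norm (g' \<xi>) = \<bar>\<xi>\<bar> / (2 * t) * exp (- \<xi>\<^sup>2 / (4 * t))"
      using t by (simp add: g'_def abs_mult)
    also have "\<dots> = (s * exp (- (s\<^sup>2 / 8))) * (1 / (2 * sqrt t) * exp (- \<xi>\<^sup>2 / (8 * t)))"
    proof -
      have "exp (- \<xi>\<^sup>2 / (4 * t)) = exp (- (s\<^sup>2 / 8)) * exp (- \<xi>\<^sup>2 / (8 * t))"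
        unfolding s2 exp_add[symmetric] using t by (simp add: field_simps)
      moreover have "\<bar>\<xi>\<bar> / (2 * t) = s * (1 / (2 * sqrt t))"
        using t by (simp add: s_def field_simps)
      ultimately show ?thesis by simp
    qed
    also have "\<dots> \<le> 2 * (1 / (2 * sqrt t) * exp (- \<xi>\<^sup>2 / (8 * t)))"
      using s t by (intro mult_right_mono) auto
    also have "\<dots> = 1 / sqrt t * exp (- \<xi>\<^sup>2 / (8 * t))"
      by simp
    also have "\<dots> \<le> 1 / sqrt t * (exp (D\<^sup>2 / (8 * t)) * exp (- v\<^sup>2 / (16 * t)))"
    proof -
      have "v\<^sup>2 \<le> (\<bar>\<xi>\<bar> + D)\<^sup>2"
        using \<xi> by (intro abs_le_square_iff[THEN iffD1]) (auto simp: dist_real_def)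
      also have "\<dots> \<le> 2 * \<xi>\<^sup>2 + 2 * D\<^sup>2"
        using zero_le_power2[of "\<bar>\<xi>\<bar> - D"] by (simp add: power2_eq_square algebra_simps)
      finally have "- \<xi>\<^sup>2 / (8 * t) \<le> D\<^sup>2 / (8 * t) + - v\<^sup>2 / (16 * t)"
        using t by (simp add: field_simps)
      then show ?thesis
        unfolding exp_add[symmetric] using t by (intro mult_left_mono) auto
    qed
    finally show ?thesis by (simp add: B_def mult.assoc)
  qed
  have "norm (exp (- u\<^sup>2 / (4 * t)) - exp (- v\<^sup>2 / (4 * t))) \<le> B * norm (u - v)"
    using deriv bound uv
    by (intro field_differentiable_bound[of "cball v D" "\<lambda>\<xi>. exp (- \<xi>\<^sup>2 / (4 * t))" g'])
       (auto simp: dist_real_def)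
  also have "\<dots> \<le> B * D"
    using uv t by (intro mult_left_mono) (auto simp: B_def)
  finally show ?thesis by (simp add: B_def algebra_simps)
qed

text \<open>The cube of side \<open>l\<close> with lower corner \<open>c\<close> lies in the ball of radius \<open>CARD('d) * l\<close> about
  \<open>c\<close>, and the support of the atom enters the estimates only through this ball. The conditions on the support and
  on \<open>a Q\<close> together say that \<open>a\<close> has total mass zero.\<close>
lemma atom_cases:
  fixes a :: "(real ^ 'd) set \<Rightarrow> real"
  assumes "is_atom \<beta> a"
  obtains c l where "0 < l" "total_variation a UNIV \<le> 1"
    and "total_variation a (- cball c (real CARD('d) * l)) = 0"
    and "emeasure (upper_variation a) UNIV = emeasure (lower_variation a) UNIV"
    and "\<And>x t. 0 < t \<Longrightarrow> \<bar>heat t a x\<bar> \<le> l powr (- \<beta>) * t powr (- ((real CARD('d) - \<beta>) / 2))"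
proof -
  from assms obtain c l where l: "0 < l"
    and fsm: "finite_signed_measure a"
    and supp: "signed_support a \<subseteq> cbox c (\<chi> i. c $ i + l)"
    and zero: "a (cbox c (\<chi> i. c $ i + l)) = 0"
    and size: "\<And>x t. 0 < t \<Longrightarrow> \<bar>t powr ((real CARD('d) - \<beta>) / 2) * heat t a x\<bar> \<le> l powr (- \<beta>)"
    and tv: "total_variation a UNIV \<le> 1"
    unfolding is_atom_def by blast
  define Q where "Q = cbox c (\<chi> i. c $ i + l)"
  have Qb: "Q \<in> sets borel" and "closed Q"
    by (auto simp: Q_def)
  then have off: "total_variation a (- Q) = 0"
    using supp by (intro total_variation_off_support) (auto simp: Q_def)
  have sub: "Q \<subseteq> cball c (real CARD('d) * l)"
  proof
    fix y assume y: "y \<in> Q"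
    have "norm (y - c) \<le> (\<Sum>i\<in>UNIV. \<bar>(y - c) $ i\<bar>)"
      by (rule norm_le_l1_cart)
    also have "\<dots> \<le> (\<Sum>i\<in>(UNIV::'d set). l)"
      using y by (intro sum_mono) (auto simp: Q_def mem_box_cart abs_le_iff algebra_simps)
    finally show "y \<in> cball c (real CARD('d) * l)"
      by (simp add: dist_norm norm_minus_commute)
  qed
  have split: "emeasure W UNIV = emeasure W Q"
    if "sets W = sets borel" "emeasure W (- Q) = 0" for W :: "(real ^ 'd) measure"
  proof -
    have "emeasure W (Q \<union> - Q) = emeasure W Q"
      using that Qb by (intro emeasure_Un_null_set) (auto simp: null_sets_def)
    then show ?thesis by simp
  qed
  show thesis
  proof (rule that[OF l tv])
    show "total_variation a (- cball c (real CARD('d) * l)) = 0"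
    proof -
      have "- cball c (real CARD('d) * l) \<subseteq> - Q" using sub by auto
      then have "total_variation a (- cball c (real CARD('d) * l)) \<le> total_variation a (- Q)"
        unfolding total_variation_def using Qb by (intro add_mono emeasure_mono) auto
      with off show ?thesis by simp
    qed
    show "emeasure (upper_variation a) UNIV = emeasure (lower_variation a) UNIV"
      using off split[of "upper_variation a"] split[of "lower_variation a"]
        upper_variation_eq_lower_variation_null[OF fsm Qb] zero
      by (simp add: total_variation_def Q_def)
    show "\<bar>heat t a x\<bar> \<le> l powr (- \<beta>) * t powr (- ((real CARD('d) - \<beta>) / 2))" if t: "0 < t" for x t
    proof -
      have "\<bar>heat t a x\<bar>
          = \<bar>t powr ((real CARD('d) - \<beta>) / 2) * heat t a x\<bar> * t powr (- ((real CARD('d) - \<beta>) / 2))"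
        using t by (simp add: abs_mult powr_minus)
      also have "\<dots> \<le> l powr (- \<beta>) * t powr (- ((real CARD('d) - \<beta>) / 2))"
        by (intro mult_right_mono size[OF t]) simp
      finally show ?thesis .
    qed
  qed
qed

text \<open>A point at distance at least \<open>2 * D\<close> from \<open>c\<close> is at least half as far from every point of the
  ball of radius \<open>D\<close>. Half of the resulting exponent is kept to integrate in \<open>x\<close>, the other half
  is bounded by means of \<open>D\<close> to beat the singularity at \<open>t = 0\<close>.\<close>
lemma heat_far_bound:
  fixes a :: "(real ^ 'd) set \<Rightarrow> real"
  assumes tv: "total_variation a UNIV \<le> 1" and off: "total_variation a (- cball c D) = 0"
    and t: "0 < t" and D: "0 \<le> D" and far: "2 * D \<le> norm (x - c)"
  shows "\<bar>heat t a x\<bar> \<le> (4 * pi * t) powr (- real CARD('d) / 2) * exp (- D\<^sup>2 / (8 * t))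
      * exp (- (norm (x - c))\<^sup>2 / (32 * t))"
  unfolding heat_eq_signed_integral
proof (rule abs_signed_integral_le[OF tv off])
  fix y assume "y \<in> cball c D"
  then have "norm (x - c) - D \<le> norm (x - y)"
    using norm_triangle_ineq[of "x - y" "y - c"] by (simp add: dist_norm norm_minus_commute)
  with far have "norm (x - c) \<le> 2 * norm (x - y)" by simp
  then have "(norm (x - c))\<^sup>2 \<le> (2 * norm (x - y))\<^sup>2"
    by (intro power_mono) auto
  moreover have "(2 * D)\<^sup>2 \<le> (norm (x - c))\<^sup>2"
    using far D by (intro power_mono) auto
  ultimately have "- (norm (x - y))\<^sup>2 / (4 * t) \<le> - D\<^sup>2 / (8 * t) + - (norm (x - c))\<^sup>2 / (32 * t)"
    using t by (simp add: field_simps)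
  then have "exp (- (norm (x - y))\<^sup>2 / (4 * t)) \<le> exp (- D\<^sup>2 / (8 * t)) * exp (- (norm (x - c))\<^sup>2 / (32 * t))"
    unfolding exp_add[symmetric] by simp
  then show "\<bar>heat_kernel t (x - y)\<bar> \<le> (4 * pi * t) powr (- real CARD('d) / 2) * exp (- D\<^sup>2 / (8 * t))
      * exp (- (norm (x - c))\<^sup>2 / (32 * t))"
    by (simp add: heat_kernel_def abs_mult mult.assoc mult_left_mono)
qed auto

text \<open>Subtracting the kernel at \<open>c\<close> gains the factor \<open>D / sqrt t\<close> over the trivial bound; it is
  what makes the time integral converge at infinity.\<close>
lemma heat_cancellation_bound:
  fixes a :: "(real ^ 'd) set \<Rightarrow> real"
  assumes tv: "total_variation a UNIV \<le> 1" and off: "total_variation a (- cball c D) = 0"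
    and bal: "emeasure (upper_variation a) UNIV = emeasure (lower_variation a) UNIV"
    and t: "0 < t" and D: "0 \<le> D"
  shows "\<bar>heat t a x\<bar> \<le> (4 * pi * t) powr (- real CARD('d) / 2) *
    (D / sqrt t * exp (D\<^sup>2 / (8 * t)) * exp (- (norm (x - c))\<^sup>2 / (16 * t)))"
proof -
  have "total_variation a UNIV < \<infinity>"
    using tv by (rule order_le_less_trans) simp
  then have "heat t a x = signed_integral a (\<lambda>y. heat_kernel t (x - y) - heat_kernel t (x - c))"
    unfolding heat_eq_signed_integral
    using abs_heat_kernel_le[OF t]
    by (intro signed_integral_diff_const[symmetric, OF _ bal measurable_heat_kernel])
  also have "\<bar>\<dots>\<bar> \<le> (4 * pi * t) powr (- real CARD('d) / 2) *
    (D / sqrt t * exp (D\<^sup>2 / (8 * t)) * exp (- (norm (x - c))\<^sup>2 / (16 * t)))"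
  proof (rule abs_signed_integral_le[OF tv off])
    fix y assume y: "y \<in> cball c D"
    have "\<bar>norm (x - y) - norm (x - c)\<bar> \<le> norm ((x - y) - (x - c))"
      by (rule norm_triangle_ineq3)
    also have "\<dots> \<le> D"
      using y by (simp add: dist_norm)
    finally have "\<bar>exp (- (norm (x - y))\<^sup>2 / (4 * t)) - exp (- (norm (x - c))\<^sup>2 / (4 * t))\<bar>
      \<le> D / sqrt t * exp (D\<^sup>2 / (8 * t)) * exp (- (norm (x - c))\<^sup>2 / (16 * t))"
      by (rule exp_neg_square_lipschitz[OF t])
    then have "(4 * pi * t) powr (- real CARD('d) / 2) *
       \<bar>exp (- (norm (x - y))\<^sup>2 / (4 * t)) - exp (- (norm (x - c))\<^sup>2 / (4 * t))\<bar>
      \<le> (4 * pi * t) powr (- real CARD('d) / 2) *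
        (D / sqrt t * exp (D\<^sup>2 / (8 * t)) * exp (- (norm (x - c))\<^sup>2 / (16 * t)))"
      by (intro mult_left_mono) auto
    then show "\<bar>heat_kernel t (x - y) - heat_kernel t (x - c)\<bar> \<le> (4 * pi * t) powr (- real CARD('d) / 2) *
        (D / sqrt t * exp (D\<^sup>2 / (8 * t)) * exp (- (norm (x - c))\<^sup>2 / (16 * t)))"
      unfolding heat_kernel_def right_diff_distrib[symmetric] by (simp add: abs_mult)
  qed (use t D in auto)
  finally show ?thesis .
qed

section \<open>Gaussian integrals against a measure of polynomial growth\<close>

definition ball_growth :: "real \<Rightarrow> real \<Rightarrow> 'a::metric_space measure \<Rightarrow> bool" where
  "ball_growth C \<gamma> \<nu> \<longleftrightarrow> sets \<nu> = sets borel \<and>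
     (\<forall>x r. 0 < r \<longrightarrow> emeasure \<nu> (ball x r) \<le> ennreal (C * r powr \<gamma>))"

lemma ball_growth_space: "ball_growth C \<gamma> \<nu> \<Longrightarrow> space \<nu> = UNIV"
  using sets_eq_imp_space_eq[of \<nu> borel] by (simp add: ball_growth_def)

lemma ball_growth_sigma_finite:
  assumes "ball_growth C \<gamma> \<nu>"
  shows "sigma_finite_measure \<nu>"
proof
  show "\<exists>A. countable A \<and> A \<subseteq> sets \<nu> \<and> \<Union>A = space \<nu> \<and> (\<forall>a\<in>A. emeasure \<nu> a \<noteq> \<infinity>)"
  proof (intro exI conjI ballI)
    show "\<Union>(range (\<lambda>n. ball undefined (real (Suc n)))) = space \<nu>"
      unfolding ball_growth_space[OF assms]
    proof (intro equalityI subsetI)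
      fix x :: 'a
      obtain n where "dist undefined x < real n"
        using reals_Archimedean2 by blast
      then have "x \<in> ball undefined (real (Suc n))" by simp
      then show "x \<in> \<Union>(range (\<lambda>n. ball undefined (real (Suc n))))" by blast
    qed simp
    fix b assume "b \<in> range (\<lambda>n. ball undefined (real (Suc n)) :: 'a set)"
    then obtain n where "b = ball undefined (real (Suc n))" by blast
    moreover have "emeasure \<nu> (ball undefined (real (Suc n))) \<le> ennreal (C * real (Suc n) powr \<gamma>)"
      using assms unfolding ball_growth_def by (meson of_nat_0_less_iff zero_less_Suc)
    ultimately show "emeasure \<nu> b \<noteq> \<infinity>"
      by (metis ennreal_less_top infinity_ennreal_def not_le top.extremum_unique order.refl order_le_less_trans less_irrefl)
  qed (use assms in \<open>auto simp: ball_growth_def\<close>)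
qed

definition gaussian_constant :: "real \<Rightarrow> real \<Rightarrow> real" where
  "gaussian_constant C \<gamma> = C * (\<Sum>k. exp (- real k) * (real k + 1) powr (\<gamma> / 2))"

text \<open>Raising \<open>w / q \<le> exp (w / q)\<close> to the power \<open>q = \<bar>p\<bar> + 2\<close> shows that the exponential beats
  \<open>w powr p\<close> with a factor \<open>w\<^sup>2\<close> to spare.\<close>
lemma summable_gaussian_constant: "summable (\<lambda>k. exp (- real k) * (real k + 1) powr p)"
proof (rule summable_comparison_test)
  define q where "q = \<bar>p\<bar> + 2"
  have q: "0 < q" by (simp add: q_def)
  have "summable (\<lambda>k. exp 1 * q powr q * inverse (real (Suc k) ^ 2))"
    using inverse_power_summable[of 2, where ?'a = real]
    by (intro summable_mult) (subst summable_Suc_iff, simp)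
  then show "summable (\<lambda>k. exp 1 * q powr q * inverse ((real k + 1) ^ 2))"
    by (simp add: add.commute)
  show "\<exists>N. \<forall>k\<ge>N. norm (exp (- real k) * (real k + 1) powr p)
      \<le> exp 1 * q powr q * inverse ((real k + 1) ^ 2)"
  proof (intro exI allI impI)
    fix k :: nat
    define w where "w = real k + 1"
    have w: "1 \<le> w" by (simp add: w_def)
    have "(w / q) powr q \<le> exp (w / q) powr q"
      using w q exp_ge_add_one_self[of "w / q"] by (intro powr_mono2) (auto simp del: exp_ge_add_one_self)
    also have "\<dots> = exp w"
      using q by (simp add: exp_powr_real)
    finally have "w powr q \<le> q powr q * exp w"
      using w q by (simp add: powr_divide field_simps)
    then have le: "w powr (\<bar>p\<bar> + 2) \<le> q powr q * exp w"
      by (simp add: q_def)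
    have "w powr p * w ^ 2 \<le> w powr \<bar>p\<bar> * w ^ 2"
      using w by (intro mult_right_mono powr_mono) auto
    also have "\<dots> = w powr (\<bar>p\<bar> + 2)"
      using w by (simp add: powr_add powr_numeral)
    finally have "w powr p * w ^ 2 \<le> q powr q * exp w"
      using le by simp
    then have "exp (- w) * w powr p \<le> q powr q * inverse (w ^ 2)"
      using w by (simp add: exp_minus field_simps)
    then have "exp 1 * (exp (- w) * w powr p) \<le> exp 1 * (q powr q * inverse (w ^ 2))"
      by (intro mult_left_mono) auto
    moreover have "exp (- real k) = exp 1 * exp (- w)"
      by (simp add: w_def exp_add[symmetric])
    ultimately show "norm (exp (- real k) * (real k + 1) powr p)
      \<le> exp 1 * q powr q * inverse ((real k + 1) ^ 2)"
      by (simp add: w_def mult.assoc)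
  qed
qed

lemma gaussian_constant_nonneg: "0 \<le> C \<Longrightarrow> 0 \<le> gaussian_constant C \<gamma>"
  unfolding gaussian_constant_def
  by (intro mult_nonneg_nonneg suminf_nonneg summable_gaussian_constant) auto

text \<open>On the shell where \<open>(norm (x - z))\<^sup>2 / s\<close> has integer part \<open>k\<close> the Gaussian is at most
  \<open>exp (- k)\<close>, and that shell lies in the ball of radius \<open>sqrt (s * (k + 1))\<close>.\<close>
lemma nn_integral_gaussian_le:
  fixes \<nu> :: "'a::real_normed_vector measure"
  assumes \<nu>: "ball_growth C \<gamma> \<nu>" and C: "0 \<le> C" and s: "0 < s"
  shows "(\<integral>\<^sup>+x. ennreal (exp (- (norm (x - z))\<^sup>2 / s)) \<partial>\<nu>)
    \<le> ennreal (gaussian_constant C \<gamma> * s powr (\<gamma> / 2))"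
proof -
  have sets: "ball z r \<in> sets \<nu>" for r
    using \<nu> by (simp add: ball_growth_def)
  define R where "R k = sqrt (s * (real k + 1))" for k :: nat
  have R: "0 < R k" "R k powr \<gamma> = s powr (\<gamma> / 2) * (real k + 1) powr (\<gamma> / 2)" for k
    using s by (simp_all add: R_def powr_half_sqrt[symmetric] powr_powr powr_mult)
  have "ennreal (exp (- (norm (x - z))\<^sup>2 / s))
      \<le> (\<Sum>k. ennreal (exp (- real k)) * indicator (ball z (R k)) x)" for x
  proof -
    define w where "w = (norm (x - z))\<^sup>2 / s"
    define k where "k = nat \<lfloor>w\<rfloor>"
    have w: "0 \<le> w" using s by (simp add: w_def)
    then have k: "real k \<le> w" "w < real k + 1"
      unfolding k_def by linarith+
    have "(norm (x - z))\<^sup>2 < s * (real k + 1)"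
      using k(2) s by (simp add: w_def field_simps)
    then have "norm (x - z) < R k"
      unfolding R_def using real_less_rsqrt by blast
    then have x: "x \<in> ball z (R k)"
      by (simp add: dist_norm norm_minus_commute)
    have "ennreal (exp (- (norm (x - z))\<^sup>2 / s)) \<le> ennreal (exp (- real k))"
      using k(1) by (intro ennreal_leI) (simp add: w_def)
    also have "\<dots> = (\<Sum>j\<in>{k}. ennreal (exp (- real j)) * indicator (ball z (R j)) x)"
      using x by simp
    also have "\<dots> \<le> (\<Sum>j. ennreal (exp (- real j)) * indicator (ball z (R j)) x)"
      by (rule sum_le_suminf) auto
    finally show ?thesis .
  qed
  then have "(\<integral>\<^sup>+x. ennreal (exp (- (norm (x - z))\<^sup>2 / s)) \<partial>\<nu>)
      \<le> (\<integral>\<^sup>+x. (\<Sum>k. ennreal (exp (- real k)) * indicator (ball z (R k)) x) \<partial>\<nu>)"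
    by (intro nn_integral_mono)
  also have "\<dots> = (\<Sum>k. \<integral>\<^sup>+x. ennreal (exp (- real k)) * indicator (ball z (R k)) x \<partial>\<nu>)"
    using sets by (intro nn_integral_suminf) simp
  also have "\<dots> = (\<Sum>k. ennreal (exp (- real k)) * emeasure \<nu> (ball z (R k)))"
    using sets by (simp add: nn_integral_cmult_indicator)
  also have "\<dots> \<le> (\<Sum>k. ennreal (exp (- real k) * (C * R k powr \<gamma>)))"
  proof (intro suminf_le)
    fix k
    have "emeasure \<nu> (ball z (R k)) \<le> ennreal (C * R k powr \<gamma>)"
      using \<nu> R(1) unfolding ball_growth_def by blast
    then show "ennreal (exp (- real k)) * emeasure \<nu> (ball z (R k)) \<le> ennreal (exp (- real k) * (C * R k powr \<gamma>))"
      using C by (subst ennreal_mult) (auto intro: mult_left_mono)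
  qed auto
  also have "\<dots> = (\<Sum>k. ennreal (C * s powr (\<gamma> / 2) * (exp (- real k) * (real k + 1) powr (\<gamma> / 2))))"
    by (simp add: R(2) mult_ac)
  also have "\<dots> = ennreal (\<Sum>k. C * s powr (\<gamma> / 2) * (exp (- real k) * (real k + 1) powr (\<gamma> / 2)))"
    using C by (intro suminf_ennreal2 summable_mult summable_gaussian_constant) auto
  also have "(\<Sum>k. C * s powr (\<gamma> / 2) * (exp (- real k) * (real k + 1) powr (\<gamma> / 2)))
      = gaussian_constant C \<gamma> * s powr (\<gamma> / 2)"
    by (subst suminf_mult[OF summable_gaussian_constant]) (simp add: gaussian_constant_def mult_ac)
  finally show ?thesis .
qed

section \<open>Uniform bound for atoms\<close>

lemma measurable_heat:
  assumes "total_variation a UNIV < \<infinity>"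
  shows "(\<lambda>(x, t). heat t a x) \<in> borel_measurable (borel \<Otimes>\<^sub>M borel)"
proof -
  interpret U: finite_measure "upper_variation a"
    by (rule finite_measure_variations[OF assms])
  interpret L: finite_measure "lower_variation a"
    by (rule finite_measure_variations[OF assms])
  show ?thesis
    unfolding heat_def signed_integral_def by measurable
qed

text \<open>For small times the ball of radius \<open>2 * D\<close> is handled by a uniform bound \<open>B\<close> on the heat
  extension and its complement by \<open>heat_far_bound\<close>.\<close>
lemma nn_integral_heat_small_time:
  fixes a :: "(real ^ 'd) set \<Rightarrow> real"
  assumes \<nu>: "ball_growth C \<gamma> \<nu>" and C: "0 \<le> C"
    and tv: "total_variation a UNIV \<le> 1" and off: "total_variation a (- cball c D) = 0"
    and t: "0 < t" and D: "0 < D" and B: "0 \<le> B" "\<And>x. \<bar>heat t a x\<bar> \<le> B"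
  shows "(\<integral>\<^sup>+x. ennreal \<bar>heat t a x\<bar> \<partial>\<nu>) \<le> ennreal (B * (C * (2 * D) powr \<gamma>) +
    (4 * pi * t) powr (- real CARD('d) / 2) * exp (- D\<^sup>2 / (8 * t)) *
      (gaussian_constant C \<gamma> * (32 * t) powr (\<gamma> / 2)))"
proof -
  define K where "K = (4 * pi * t) powr (- real CARD('d) / 2) * exp (- D\<^sup>2 / (8 * t))"
  have K: "0 \<le> K" by (simp add: K_def)
  have sets [measurable_cong]: "sets \<nu> = sets borel"
    using \<nu> by (simp add: ball_growth_def)
  have "ennreal \<bar>heat t a x\<bar> \<le> ennreal B * indicator (ball c (2 * D)) x +
      ennreal K * ennreal (exp (- (norm (x - c))\<^sup>2 / (32 * t)))" for x
  proof (cases "x \<in> ball c (2 * D)")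
    case True
    then show ?thesis
      using B(2)[of x] by (simp add: add_increasing2 ennreal_leI)
  next
    case False
    then have "2 * D \<le> norm (x - c)"
      by (simp add: dist_norm norm_minus_commute)
    then have "\<bar>heat t a x\<bar> \<le> K * exp (- (norm (x - c))\<^sup>2 / (32 * t))"
      unfolding K_def using D by (intro heat_far_bound[OF tv off t]) auto
    then show ?thesis
      using K False by (simp add: ennreal_mult[symmetric] ennreal_leI)
  qed
  then have "(\<integral>\<^sup>+x. ennreal \<bar>heat t a x\<bar> \<partial>\<nu>) \<le> (\<integral>\<^sup>+x. ennreal B * indicator (ball c (2 * D)) x +
      ennreal K * ennreal (exp (- (norm (x - c))\<^sup>2 / (32 * t))) \<partial>\<nu>)"
    by (intro nn_integral_mono)
  also have "\<dots> = ennreal B * emeasure \<nu> (ball c (2 * D)) +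
      ennreal K * (\<integral>\<^sup>+x. ennreal (exp (- (norm (x - c))\<^sup>2 / (32 * t))) \<partial>\<nu>)"
  proof -
    have [measurable]: "ball c (2 * D) \<in> sets \<nu>"
      by (simp add: sets)
    show ?thesis
      by (simp add: nn_integral_add nn_integral_cmult_indicator nn_integral_cmult)
  qed
  also have "\<dots> \<le> ennreal B * ennreal (C * (2 * D) powr \<gamma>) +
      ennreal K * ennreal (gaussian_constant C \<gamma> * (32 * t) powr (\<gamma> / 2))"
    using \<nu> D t by (intro add_mono mult_left_mono nn_integral_gaussian_le C) (auto simp: ball_growth_def)
  also have "\<dots> = ennreal (B * (C * (2 * D) powr \<gamma>) + K * (gaussian_constant C \<gamma> * (32 * t) powr (\<gamma> / 2)))"
    using B(1) C K gaussian_constant_nonneg[OF C] by (simp add: ennreal_mult ennreal_plus)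
  finally show ?thesis by (simp add: K_def)
qed

lemma nn_integral_heat_large_time:
  fixes a :: "(real ^ 'd) set \<Rightarrow> real"
  assumes \<nu>: "ball_growth C \<gamma> \<nu>" and C: "0 \<le> C"
    and tv: "total_variation a UNIV \<le> 1" and off: "total_variation a (- cball c D) = 0"
    and bal: "emeasure (upper_variation a) UNIV = emeasure (lower_variation a) UNIV"
    and t: "0 < t" and D: "0 < D"
  shows "(\<integral>\<^sup>+x. ennreal \<bar>heat t a x\<bar> \<partial>\<nu>) \<le> ennreal (
    (4 * pi * t) powr (- real CARD('d) / 2) * (D / sqrt t * exp (D\<^sup>2 / (8 * t))) *
      (gaussian_constant C \<gamma> * (16 * t) powr (\<gamma> / 2)))"
proof -
  define K where "K = (4 * pi * t) powr (- real CARD('d) / 2) * (D / sqrt t * exp (D\<^sup>2 / (8 * t)))"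
  have K: "0 \<le> K" using t D by (simp add: K_def)
  have sets [measurable_cong]: "sets \<nu> = sets borel"
    using \<nu> by (simp add: ball_growth_def)
  have "\<bar>heat t a x\<bar> \<le> K * exp (- (norm (x - c))\<^sup>2 / (16 * t))" for x
    using heat_cancellation_bound[OF tv off bal t] D by (simp add: K_def mult.assoc)
  then have "(\<integral>\<^sup>+x. ennreal \<bar>heat t a x\<bar> \<partial>\<nu>)
      \<le> (\<integral>\<^sup>+x. ennreal K * ennreal (exp (- (norm (x - c))\<^sup>2 / (16 * t))) \<partial>\<nu>)"
    using K by (intro nn_integral_mono) (auto simp: ennreal_mult[symmetric] intro: ennreal_leI)
  also have "\<dots> = ennreal K * (\<integral>\<^sup>+x. ennreal (exp (- (norm (x - c))\<^sup>2 / (16 * t))) \<partial>\<nu>)"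
    by (rule nn_integral_cmult) measurable
  also have "\<dots> \<le> ennreal K * ennreal (gaussian_constant C \<gamma> * (16 * t) powr (\<gamma> / 2))"
    using t by (intro mult_left_mono nn_integral_gaussian_le[OF \<nu> C]) auto
  also have "\<dots> = ennreal (K * (gaussian_constant C \<gamma> * (16 * t) powr (\<gamma> / 2)))"
    using K gaussian_constant_nonneg[OF C] by (intro ennreal_mult[symmetric]) auto
  finally show ?thesis by (simp add: K_def)
qed

text \<open>The quantity that controls the Riesz potential. The integrand is written in the form in which
  \<^const>\<open>riesz_converges\<close> unfolds, and \<open>h\<close> is arbitrary because finite atomic sums are
  also inserted.\<close>
definition heat_mass :: "real \<Rightarrow> 'a measure \<Rightarrow> ('a \<Rightarrow> real \<Rightarrow> real) \<Rightarrow> ennreal" where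
  "heat_mass \<alpha> \<nu> h =
    (\<integral>\<^sup>+x. \<integral>\<^sup>+t. ennreal \<bar>indicator {0<..} t *\<^sub>R (t powr (\<alpha> / 2 - 1) * h x t)\<bar> \<partial>lborel \<partial>\<nu>)"

text \<open>Bookkeeping of exponents with \<open>\<gamma> = n - \<alpha>\<close>. In the second summand the powers of \<open>t\<close> combine to
  \<open>1 / t\<close>, which the remaining exponential absorbs through \<open>exp (- w) \<le> 1 / w\<close>.\<close>
lemma small_time_weight:
  fixes t l n \<alpha> \<beta> \<gamma> C G :: real
  assumes t: "0 < t" and l: "0 < l" and n: "0 < n" and \<gamma>: "\<gamma> = n - \<alpha>" and C: "0 \<le> C" and G: "0 \<le> G"
  shows "t powr (\<alpha> / 2 - 1) *
      (l powr (- \<beta>) * t powr (- ((n - \<beta>) / 2)) * (C * (2 * (n * l)) powr \<gamma>) +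
       (4 * pi * t) powr (- n / 2) * exp (- (n * l)\<^sup>2 / (8 * t)) * (G * (32 * t) powr (\<gamma> / 2)))
    \<le> C * (2 * n) powr \<gamma> * l powr (- 2 * ((\<beta> - \<gamma>) / 2)) * t powr ((\<beta> - \<gamma>) / 2 - 1) +
       (4 * pi) powr (- n / 2) * G * 32 powr (\<gamma> / 2) * (8 / n\<^sup>2) * l powr (- 2)"
proof -
  have scale4: "(4 * pi * t) powr q = (4 * pi) powr q * t powr q"
    and scale32: "(32 * t) powr q = 32 powr q * t powr q" for q
    using t by (simp_all add: powr_mult)
  have 1: "t powr (\<alpha> / 2 - 1) * (l powr (- \<beta>) * t powr (- ((n - \<beta>) / 2)) * (C * (2 * (n * l)) powr \<gamma>))
      = C * (2 * n) powr \<gamma> * l powr (- 2 * ((\<beta> - \<gamma>) / 2)) * t powr ((\<beta> - \<gamma>) / 2 - 1)"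
  proof -
    have T: "t powr (\<alpha> / 2 - 1) * t powr (- ((n - \<beta>) / 2)) = t powr ((\<beta> - \<gamma>) / 2 - 1)"
      unfolding powr_add[symmetric] \<gamma> by (rule arg_cong) (simp add: field_simps)
    have L: "l powr \<gamma> * l powr (- \<beta>) = l powr (- 2 * ((\<beta> - \<gamma>) / 2))"
      unfolding powr_add[symmetric] by (rule arg_cong) simp
    have N: "(2 * (n * l)) powr \<gamma> = (2 * n) powr \<gamma> * l powr \<gamma>"
      using n l by (simp add: powr_mult)
    have "t powr (\<alpha> / 2 - 1) * (l powr (- \<beta>) * t powr (- ((n - \<beta>) / 2)) * (C * (2 * (n * l)) powr \<gamma>))
        = C * (2 * n) powr \<gamma> * (l powr \<gamma> * l powr (- \<beta>)) *
          (t powr (\<alpha> / 2 - 1) * t powr (- ((n - \<beta>) / 2)))"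
      unfolding N by (simp only: mult_ac)
    then show ?thesis unfolding T L .
  qed
  have 2: "exp (- (n * l)\<^sup>2 / (8 * t)) / t \<le> 8 / n\<^sup>2 * l powr (- 2)"
  proof -
    define w where "w = (n * l)\<^sup>2 / (8 * t)"
    have w: "0 < w" using n l t by (simp add: w_def)
    have "w \<le> exp w"
      using exp_ge_add_one_self[of w] by linarith
    then have "exp (- w) \<le> 1 / w"
      using w by (simp add: exp_minus field_simps)
    then have "exp (- w) / t \<le> 1 / w / t"
      using t by (intro divide_right_mono) auto
    also have "1 / w / t = 8 / n\<^sup>2 * l powr (- 2)"
      using n l t by (simp add: w_def powr_minus powr_numeral power_mult_distrib field_simps)
    finally show ?thesis by (simp add: w_def)
  qed
  have 3: "t powr (\<alpha> / 2 - 1) *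
      ((4 * pi * t) powr (- n / 2) * exp (- (n * l)\<^sup>2 / (8 * t)) * (G * (32 * t) powr (\<gamma> / 2)))
    = (4 * pi) powr (- n / 2) * G * 32 powr (\<gamma> / 2) * (exp (- (n * l)\<^sup>2 / (8 * t)) / t)"
  proof -
    have "t powr (\<alpha> / 2 - 1) * t powr (- n / 2) * t powr (\<gamma> / 2) = t powr (- 1)"
      unfolding powr_add[symmetric] \<gamma> by (rule arg_cong) (simp add: field_simps)
    then have e: "t powr (\<alpha> / 2 - 1) * t powr (- n / 2) * t powr (\<gamma> / 2) = 1 / t"
      using t by (simp add: powr_minus_divide)
    have "t powr (\<alpha> / 2 - 1) *
      ((4 * pi * t) powr (- n / 2) * exp (- (n * l)\<^sup>2 / (8 * t)) * (G * (32 * t) powr (\<gamma> / 2)))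
      = (4 * pi) powr (- n / 2) * G * 32 powr (\<gamma> / 2) * exp (- (n * l)\<^sup>2 / (8 * t)) *
        (t powr (\<alpha> / 2 - 1) * t powr (- n / 2) * t powr (\<gamma> / 2))"
      unfolding scale4 scale32 by (simp only: mult_ac)
    then show ?thesis unfolding e by simp
  qed
  have "(4 * pi) powr (- n / 2) * G * 32 powr (\<gamma> / 2) * (exp (- (n * l)\<^sup>2 / (8 * t)) / t)
    \<le> (4 * pi) powr (- n / 2) * G * 32 powr (\<gamma> / 2) * (8 / n\<^sup>2 * l powr (- 2))"
    using G by (intro mult_left_mono 2) auto
  then show ?thesis
    unfolding distrib_left 1 3 by (simp only: mult.assoc)
qed

lemma large_time_weight:
  fixes t l n \<alpha> \<gamma> G :: real
  assumes l: "0 < l" and t: "l\<^sup>2 \<le> t" and n: "0 < n" and \<gamma>: "\<gamma> = n - \<alpha>" and G: "0 \<le> G"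
  shows "t powr (\<alpha> / 2 - 1) *
      ((4 * pi * t) powr (- n / 2) * (n * l / sqrt t * exp ((n * l)\<^sup>2 / (8 * t))) *
        (G * (16 * t) powr (\<gamma> / 2)))
    \<le> (4 * pi) powr (- n / 2) * n * exp (n\<^sup>2 / 8) * G * 16 powr (\<gamma> / 2) * l * t powr (- 3 / 2)"
proof -
  have t0: "0 < t"
    using l t by (meson order_less_le_trans zero_less_power)
  have scale4: "(4 * pi * t) powr q = (4 * pi) powr q * t powr q"
    and scale16: "(16 * t) powr q = 16 powr q * t powr q" for q
    using t0 by (simp_all add: powr_mult)
  have e: "t powr (\<alpha> / 2 - 1) * t powr (- n / 2) * t powr (\<gamma> / 2) * t powr (- 1 / 2) = t powr (- 3 / 2)"
    unfolding powr_add[symmetric] \<gamma> by (rule arg_cong) (simp add: field_simps)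
  have "1 / sqrt t = t powr (- 1 / 2)"
    using t0 by (simp add: powr_half_sqrt[symmetric] powr_minus_divide)
  then have s: "n * l / sqrt t = n * l * t powr (- 1 / 2)"
    by (metis times_divide_eq_right mult.right_neutral)
  have "(n * l)\<^sup>2 / (8 * t) \<le> n\<^sup>2 / 8"
    using t t0 mult_left_mono[OF t, of "n\<^sup>2"] by (simp add: power_mult_distrib field_simps)
  then have ex: "exp ((n * l)\<^sup>2 / (8 * t)) \<le> exp (n\<^sup>2 / 8)" by simp
  have "t powr (\<alpha> / 2 - 1) *
      ((4 * pi * t) powr (- n / 2) * (n * l / sqrt t * exp ((n * l)\<^sup>2 / (8 * t))) *
        (G * (16 * t) powr (\<gamma> / 2)))
    = (4 * pi) powr (- n / 2) * n * G * 16 powr (\<gamma> / 2) * l *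
      (t powr (\<alpha> / 2 - 1) * t powr (- n / 2) * t powr (\<gamma> / 2) * t powr (- 1 / 2)) *
      exp ((n * l)\<^sup>2 / (8 * t))"
    unfolding s scale4 scale16 by (simp only: mult_ac)
  also have "\<dots> \<le> (4 * pi) powr (- n / 2) * n * G * 16 powr (\<gamma> / 2) * l *
      (t powr (\<alpha> / 2 - 1) * t powr (- n / 2) * t powr (\<gamma> / 2) * t powr (- 1 / 2)) * exp (n\<^sup>2 / 8)"
    using n l G by (intro mult_left_mono ex mult_nonneg_nonneg) auto
  finally show ?thesis
    unfolding e by (simp only: mult_ac)
qed

text \<open>The value does not depend on \<open>l\<close>. This scale invariance is what makes the bound
  uniform over all atoms.\<close>
lemma nn_integral_time_profile:
  fixes A B E l p :: real
  assumes A: "0 \<le> A" and B: "0 \<le> B" and E: "0 \<le> E" and l: "0 < l" and p: "0 < p"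
  shows "(\<integral>\<^sup>+t. ennreal (A * l powr (- 2 * p) * t powr (p - 1) + B * l powr (- 2)) * indicator {0..l\<^sup>2} t +
      ennreal (E * l * t powr (- 3 / 2)) * indicator {l\<^sup>2..} t \<partial>lborel) = ennreal (A / p + B + 2 * E)"
proof -
  have l2: "0 < l\<^sup>2" using l by simp
  have pow: "(l\<^sup>2) powr q = l powr (2 * q)" for q
    using l powr_powr[of l 2 q] by simp
  have i1: "(\<integral>\<^sup>+t. ennreal (t powr (p - 1)) * indicator {0..l\<^sup>2} t \<partial>lborel) = ennreal (l powr (2 * p) / p)"
    using has_integral_powr_from_0[of "p - 1" "l\<^sup>2"] p
    by (intro nn_integral_has_integral_lebesgue') (auto simp: pow)
  have i2: "(\<integral>\<^sup>+t. ennreal (t powr (- 3 / 2)) * indicator {l\<^sup>2..} t \<partial>lborel) = ennreal (2 / l)"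
  proof (intro nn_integral_has_integral_lebesgue')
    have "- ((l\<^sup>2) powr (- 3 / 2 + 1)) / (- 3 / 2 + 1) = 2 / l"
      using l by (simp add: pow powr_minus_divide)
    then show "((\<lambda>t. t powr (- 3 / 2)) has_integral 2 / l) {l\<^sup>2..}"
      using has_integral_powr_to_inf[of "- 3 / 2" "l\<^sup>2"] l2 by simp
  qed simp
  have "(\<integral>\<^sup>+t. ennreal (A * l powr (- 2 * p) * t powr (p - 1) + B * l powr (- 2)) * indicator {0..l\<^sup>2} t +
      ennreal (E * l * t powr (- 3 / 2)) * indicator {l\<^sup>2..} t \<partial>lborel)
    = (\<integral>\<^sup>+t. ennreal (A * l powr (- 2 * p)) * (ennreal (t powr (p - 1)) * indicator {0..l\<^sup>2} t) +
        ennreal (B * l powr (- 2)) * indicator {0..l\<^sup>2} t +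
        ennreal (E * l) * (ennreal (t powr (- 3 / 2)) * indicator {l\<^sup>2..} t) \<partial>lborel)"
    using A B E l by (intro nn_integral_cong) (auto simp: ennreal_mult ennreal_plus split: split_indicator)
  also have "\<dots> = ennreal (A * l powr (- 2 * p)) * ennreal (l powr (2 * p) / p) +
      ennreal (B * l powr (- 2)) * ennreal (l\<^sup>2) + ennreal (E * l) * ennreal (2 / l)"
    by (simp add: nn_integral_add nn_integral_cmult nn_integral_cmult_indicator i1 i2[simplified])
  also have "\<dots> = ennreal (A / p + B + 2 * E)"
  proof -
    have mult: "ennreal x * ennreal y = ennreal z" if "x * y = z" "0 \<le> y" for x y z
      using ennreal_mult''[OF that(2), of x] that(1) by simp
    have a: "A * l powr (- 2 * p) * (l powr (2 * p) / p) = A / p"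
      using l by (simp add: powr_minus field_simps)
    have b: "B * l powr (- 2) * l\<^sup>2 = B"
      using l by (simp add: powr_minus powr_numeral field_simps)
    have c: "E * l * (2 / l) = 2 * E"
      using l by simp
    show ?thesis
      using A B E l p by (subst mult[OF a], simp, subst mult[OF b], simp, subst mult[OF c]) simp_all
  qed
  finally show ?thesis .
qed

text \<open>The assumption \<open>CARD('d) - \<beta> < \<alpha>\<close> enters as \<open>0 < p\<close>, the integrability at \<open>t = 0\<close> of the
  contribution near the cube.\<close>
lemma heat_mass_atom_bounded:
  fixes \<alpha> \<beta> C :: real
  assumes \<alpha>: "real CARD('d::finite) - \<beta> < \<alpha>" and C: "0 < C"
  shows "\<exists>K>0. \<forall>(\<nu> :: (real ^ 'd) measure) a. ball_growth C (real CARD('d) - \<alpha>) \<nu> \<longrightarrow> is_atom \<beta> a \<longrightarrow>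
    heat_mass \<alpha> \<nu> (\<lambda>x t. heat t a x) \<le> ennreal K"
proof -
  define n where "n = real CARD('d)"
  define \<gamma> where "\<gamma> = n - \<alpha>"
  define p where "p = (\<beta> - \<gamma>) / 2"
  define G where "G = gaussian_constant C \<gamma>"
  define A where "A = C * (2 * n) powr \<gamma>"
  define B where "B = (4 * pi) powr (- n / 2) * G * 32 powr (\<gamma> / 2) * (8 / n\<^sup>2)"
  define E where "E = (4 * pi) powr (- n / 2) * n * exp (n\<^sup>2 / 8) * G * 16 powr (\<gamma> / 2)"
  have n: "0 < n" by (simp add: n_def)
  have p: "0 < p" using \<alpha> by (simp add: p_def \<gamma>_def n_def)
  have G: "0 \<le> G" using C by (simp add: G_def gaussian_constant_nonneg)
  have A: "0 < A" using C n by (simp add: A_def)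
  have B: "0 \<le> B" using G n by (simp add: B_def)
  have E: "0 \<le> E" using G n by (simp add: E_def)
  have main: "heat_mass \<alpha> \<nu> (\<lambda>x t. heat t a x) \<le> ennreal (A / p + B + 2 * E)"
    if \<nu>: "ball_growth C \<gamma> \<nu>" and atom: "is_atom \<beta> a" for \<nu> :: "(real ^ 'd) measure" and a
  proof -
    from atom obtain c l where l: "0 < l" and tv: "total_variation a UNIV \<le> 1"
      and off: "total_variation a (- cball c (n * l)) = 0"
      and bal: "emeasure (upper_variation a) UNIV = emeasure (lower_variation a) UNIV"
      and size: "\<And>x t. 0 < t \<Longrightarrow> \<bar>heat t a x\<bar> \<le> l powr (- \<beta>) * t powr (- ((n - \<beta>) / 2))"
      unfolding n_def by (rule atom_cases) blast
    have D: "0 < n * l" using n l by simp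
    have sets [measurable_cong]: "sets \<nu> = sets borel"
      using \<nu> by (simp add: ball_growth_def)
    interpret \<nu>: sigma_finite_measure \<nu> by (rule ball_growth_sigma_finite[OF \<nu>])
    interpret pair_sigma_finite \<nu> lborel ..
    have "total_variation a UNIV < \<infinity>"
      using tv by (rule order_le_less_trans) simp
    from measurable_heat[OF this]
    have [measurable]: "(\<lambda>(x, t). heat t a x) \<in> borel_measurable (\<nu> \<Otimes>\<^sub>M lborel)"
      by (simp cong: measurable_cong_sets add: sets sets_pair_measure_cong[OF sets sets_lborel])
    have "heat_mass \<alpha> \<nu> (\<lambda>x t. heat t a x) =
      (\<integral>\<^sup>+t. \<integral>\<^sup>+x. ennreal \<bar>indicator {0<..} t *\<^sub>R (t powr (\<alpha> / 2 - 1) * heat t a x)\<bar> \<partial>\<nu> \<partial>lborel)"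
      unfolding heat_mass_def by (rule Fubini'[symmetric]) measurable
    also have "\<dots> \<le> (\<integral>\<^sup>+t. ennreal (A * l powr (- 2 * p) * t powr (p - 1) + B * l powr (- 2)) * indicator {0..l\<^sup>2} t +
      ennreal (E * l * t powr (- 3 / 2)) * indicator {l\<^sup>2..} t \<partial>lborel)"
    proof (rule nn_integral_mono)
      fix t :: real
      consider "t \<le> 0" | "0 < t" "t \<le> l\<^sup>2" | "0 < t" "l\<^sup>2 < t" by linarith
      then show "(\<integral>\<^sup>+x. ennreal \<bar>indicator {0<..} t *\<^sub>R (t powr (\<alpha> / 2 - 1) * heat t a x)\<bar> \<partial>\<nu>)
        \<le> ennreal (A * l powr (- 2 * p) * t powr (p - 1) + B * l powr (- 2)) * indicator {0..l\<^sup>2} t +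
          ennreal (E * l * t powr (- 3 / 2)) * indicator {l\<^sup>2..} t"
      proof cases
        case 1
        then show ?thesis by simp
      next
        case t: 2
        have "(\<integral>\<^sup>+x. ennreal \<bar>indicator {0<..} t *\<^sub>R (t powr (\<alpha> / 2 - 1) * heat t a x)\<bar> \<partial>\<nu>)
          = ennreal (t powr (\<alpha> / 2 - 1)) * (\<integral>\<^sup>+x. ennreal \<bar>heat t a x\<bar> \<partial>\<nu>)"
          using t(1) by (simp add: abs_mult ennreal_mult nn_integral_cmult)
        also have "\<dots> \<le> ennreal (t powr (\<alpha> / 2 - 1)) *
          ennreal (l powr (- \<beta>) * t powr (- ((n - \<beta>) / 2)) * (C * (2 * (n * l)) powr \<gamma>) +
            (4 * pi * t) powr (- n / 2) * exp (- (n * l)\<^sup>2 / (8 * t)) * (G * (32 * t) powr (\<gamma> / 2)))"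
          unfolding n_def G_def using C
          by (intro mult_left_mono nn_integral_heat_small_time[OF \<nu> _ tv off[unfolded n_def] t(1) D[unfolded n_def] _ size[OF t(1), unfolded n_def]]) auto
        also have "\<dots> = ennreal (t powr (\<alpha> / 2 - 1) *
          (l powr (- \<beta>) * t powr (- ((n - \<beta>) / 2)) * (C * (2 * (n * l)) powr \<gamma>) +
            (4 * pi * t) powr (- n / 2) * exp (- (n * l)\<^sup>2 / (8 * t)) * (G * (32 * t) powr (\<gamma> / 2))))"
          by (rule ennreal_mult'[symmetric]) simp
        also have "\<dots> \<le> ennreal (A * l powr (- 2 * p) * t powr (p - 1) + B * l powr (- 2))"
          unfolding A_def B_def p_def using C
          by (intro ennreal_leI small_time_weight t(1) l n \<gamma>_def G) auto
        also have "\<dots> \<le> ennreal (A * l powr (- 2 * p) * t powr (p - 1) + B * l powr (- 2)) * indicator {0..l\<^sup>2} t +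
          ennreal (E * l * t powr (- 3 / 2)) * indicator {l\<^sup>2..} t"
          using t by (simp del: ennreal_plus)
        finally show ?thesis .
      next
        case t: 3
        have "(\<integral>\<^sup>+x. ennreal \<bar>indicator {0<..} t *\<^sub>R (t powr (\<alpha> / 2 - 1) * heat t a x)\<bar> \<partial>\<nu>)
          = ennreal (t powr (\<alpha> / 2 - 1)) * (\<integral>\<^sup>+x. ennreal \<bar>heat t a x\<bar> \<partial>\<nu>)"
          using t(1) by (simp add: abs_mult ennreal_mult nn_integral_cmult)
        also have "\<dots> \<le> ennreal (t powr (\<alpha> / 2 - 1)) *
          ennreal ((4 * pi * t) powr (- n / 2) * (n * l / sqrt t * exp ((n * l)\<^sup>2 / (8 * t))) *
            (G * (16 * t) powr (\<gamma> / 2)))"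
          unfolding n_def G_def using C
          by (intro mult_left_mono nn_integral_heat_large_time[OF \<nu> _ tv off[unfolded n_def] bal t(1) D[unfolded n_def]]) auto
        also have "\<dots> = ennreal (t powr (\<alpha> / 2 - 1) *
          ((4 * pi * t) powr (- n / 2) * (n * l / sqrt t * exp ((n * l)\<^sup>2 / (8 * t))) *
            (G * (16 * t) powr (\<gamma> / 2))))"
          by (rule ennreal_mult'[symmetric]) simp
        also have "\<dots> \<le> ennreal (E * l * t powr (- 3 / 2))"
          unfolding E_def using t(2) by (intro ennreal_leI large_time_weight l n \<gamma>_def G) auto
        also have "\<dots> \<le> ennreal (A * l powr (- 2 * p) * t powr (p - 1) + B * l powr (- 2)) * indicator {0..l\<^sup>2} t +
          ennreal (E * l * t powr (- 3 / 2)) * indicator {l\<^sup>2..} t"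
          using t by simp
        finally show ?thesis .
      qed
    qed
    also have "\<dots> = ennreal (A / p + B + 2 * E)"
      using A B E l p by (intro nn_integral_time_profile) auto
    finally show ?thesis .
  qed
  moreover have "0 < A / p + B + 2 * E"
    using A B E p by (simp add: add_pos_nonneg)
  ultimately show ?thesis
    unfolding n_def[symmetric] \<gamma>_def[symmetric] by blast
qed

section \<open>Passage to weak-star limits\<close>

lemma heat_mass_sum_le:
  assumes I: "finite I"
    and meas: "\<And>i. i \<in> I \<Longrightarrow> (\<lambda>(x, t). h i x t) \<in> borel_measurable (\<nu> \<Otimes>\<^sub>M lborel)"
  shows "heat_mass \<alpha> \<nu> (\<lambda>x t. \<Sum>i\<in>I. c i * h i x t) \<le> (\<Sum>i\<in>I. ennreal \<bar>c i\<bar> * heat_mass \<alpha> \<nu> (h i))"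
proof -
  let ?w = "\<lambda>t. indicator {0<..} t * t powr (\<alpha> / 2 - 1) :: real"
  have m: "(\<lambda>(x, t). ennreal \<bar>?w t * h i x t\<bar>) \<in> borel_measurable (\<nu> \<Otimes>\<^sub>M lborel)" if "i \<in> I" for i
  proof -
    note meas[OF that, measurable]
    show ?thesis by measurable
  qed
  have mt: "(\<lambda>t. ennreal \<bar>?w t * h i x t\<bar>) \<in> borel_measurable lborel" if "i \<in> I" "x \<in> space \<nu>" for i x
    using measurable_compose_Pair1[OF that(2) m[OF that(1)]] by simp
  have mx: "(\<lambda>x. \<integral>\<^sup>+t. ennreal \<bar>?w t * h i x t\<bar> \<partial>lborel) \<in> borel_measurable \<nu>" if "i \<in> I" for i
    using lborel.borel_measurable_nn_integral_fst[OF m[OF that]] by simp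
  have "heat_mass \<alpha> \<nu> (\<lambda>x t. \<Sum>i\<in>I. c i * h i x t)
     \<le> (\<integral>\<^sup>+x. \<integral>\<^sup>+t. (\<Sum>i\<in>I. ennreal \<bar>c i\<bar> * ennreal \<bar>?w t * h i x t\<bar>) \<partial>lborel \<partial>\<nu>)"
    unfolding heat_mass_def
  proof (intro nn_integral_mono)
    fix x t
    have "\<bar>indicator {0<..} t *\<^sub>R (t powr (\<alpha> / 2 - 1) * (\<Sum>i\<in>I. c i * h i x t))\<bar>
        = \<bar>\<Sum>i\<in>I. c i * (?w t * h i x t)\<bar>"
      by (simp add: sum_distrib_left mult_ac)
    also have "\<dots> \<le> (\<Sum>i\<in>I. \<bar>c i\<bar> * \<bar>?w t * h i x t\<bar>)"
      by (rule order_trans[OF sum_abs]) (simp add: abs_mult)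
    finally have "ennreal \<bar>indicator {0<..} t *\<^sub>R (t powr (\<alpha> / 2 - 1) * (\<Sum>i\<in>I. c i * h i x t))\<bar>
        \<le> ennreal (\<Sum>i\<in>I. \<bar>c i\<bar> * \<bar>?w t * h i x t\<bar>)"
      by (rule ennreal_leI)
    also have "\<dots> = (\<Sum>i\<in>I. ennreal \<bar>c i\<bar> * ennreal \<bar>?w t * h i x t\<bar>)"
      by (subst sum_ennreal[symmetric]) (auto simp: ennreal_mult)
    finally show "ennreal \<bar>indicator {0<..} t *\<^sub>R (t powr (\<alpha> / 2 - 1) * (\<Sum>i\<in>I. c i * h i x t))\<bar>
        \<le> (\<Sum>i\<in>I. ennreal \<bar>c i\<bar> * ennreal \<bar>?w t * h i x t\<bar>)" .
  qed
  also have "\<dots> = (\<integral>\<^sup>+x. (\<Sum>i\<in>I. ennreal \<bar>c i\<bar> * (\<integral>\<^sup>+t. ennreal \<bar>?w t * h i x t\<bar> \<partial>lborel)) \<partial>\<nu>)"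
    using mt by (intro nn_integral_cong) (simp add: nn_integral_sum nn_integral_cmult)
  also have "\<dots> = (\<Sum>i\<in>I. ennreal \<bar>c i\<bar> * (\<integral>\<^sup>+x. \<integral>\<^sup>+t. ennreal \<bar>?w t * h i x t\<bar> \<partial>lborel \<partial>\<nu>))"
    using mx by (simp add: nn_integral_sum nn_integral_cmult)
  also have "\<dots> = (\<Sum>i\<in>I. ennreal \<bar>c i\<bar> * heat_mass \<alpha> \<nu> (h i))"
    by (simp add: heat_mass_def mult.assoc)
  finally show ?thesis .
qed

text \<open>Fatou's lemma on the product of \<open>\<nu>\<close> with Lebesgue measure. Convergence is available only for
  positive times, so measurability of the limit is obtained with the cutoff to \<open>{0<..}\<close>.\<close>
lemma heat_mass_limit:
  assumes meas: "\<And>n. (\<lambda>(x, t). h n x t) \<in> borel_measurable (\<nu> \<Otimes>\<^sub>M lborel)"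
    and lim: "\<And>x t. 0 < t \<Longrightarrow> (\<lambda>n. h n x t) \<longlonglongrightarrow> g x t"
  shows "(\<lambda>(x, t). indicator {0<..} t *\<^sub>R (t powr (\<alpha> / 2 - 1) * g x t)) \<in> borel_measurable (\<nu> \<Otimes>\<^sub>M lborel)"
    and "heat_mass \<alpha> \<nu> g \<le> liminf (\<lambda>n. heat_mass \<alpha> \<nu> (h n))"
proof -
  let ?f = "\<lambda>n x t. indicator {0<..} t *\<^sub>R (t powr (\<alpha> / 2 - 1) * h n x t)"
  let ?g = "\<lambda>x t. indicator {0<..} t *\<^sub>R (t powr (\<alpha> / 2 - 1) * g x t)"
  have m: "(\<lambda>(x, t). ?f n x t) \<in> borel_measurable (\<nu> \<Otimes>\<^sub>M lborel)" for n
  proof -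
    note meas[of n, measurable]
    show ?thesis by measurable
  qed
  have l: "(\<lambda>n. ?f n x t) \<longlonglongrightarrow> ?g x t" for x t
    by (cases "0 < t") (auto intro!: tendsto_intros lim)
  show mg: "(\<lambda>(x, t). ?g x t) \<in> borel_measurable (\<nu> \<Otimes>\<^sub>M lborel)"
    by (rule borel_measurable_LIMSEQ_real[where u = "\<lambda>n (x, t). ?f n x t"]) (use l m in auto)
  have swap: "heat_mass \<alpha> \<nu> k = (\<integral>\<^sup>+(x, t). ennreal \<bar>indicator {0<..} t *\<^sub>R (t powr (\<alpha> / 2 - 1) * k x t)\<bar> \<partial>(\<nu> \<Otimes>\<^sub>M lborel))"
    if "(\<lambda>(x, t). indicator {0<..} t *\<^sub>R (t powr (\<alpha> / 2 - 1) * k x t) :: real) \<in> borel_measurable (\<nu> \<Otimes>\<^sub>M lborel)" for k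
  proof -
    have "(\<lambda>p. ennreal \<bar>case p of (x, t) \<Rightarrow> indicator {0<..} t *\<^sub>R (t powr (\<alpha> / 2 - 1) * k x t)\<bar>)
        \<in> borel_measurable (\<nu> \<Otimes>\<^sub>M lborel)"
      using that by (intro measurable_compose[OF _ measurable_ennreal] borel_measurable_abs)
    from lborel.nn_integral_fst[OF this] show ?thesis
      by (simp add: heat_mass_def split_beta')
  qed
  have e: "ennreal \<bar>?g x t\<bar> = liminf (\<lambda>n. ennreal \<bar>?f n x t\<bar>)" for x t
    by (rule lim_imp_Liminf[symmetric]) (simp, intro tendsto_ennrealI tendsto_rabs l)
  have "heat_mass \<alpha> \<nu> g = (\<integral>\<^sup>+p. liminf (\<lambda>n. case p of (x, t) \<Rightarrow> ennreal \<bar>?f n x t\<bar>) \<partial>(\<nu> \<Otimes>\<^sub>M lborel))"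
    unfolding swap[OF mg] by (intro nn_integral_cong) (simp only: split_beta' e)
  also have "\<dots> \<le> liminf (\<lambda>n. \<integral>\<^sup>+(x, t). ennreal \<bar>?f n x t\<bar> \<partial>(\<nu> \<Otimes>\<^sub>M lborel))"
  proof (rule nn_integral_liminf)
    fix n
    note m[of n, measurable]
    show "(\<lambda>(x, t). ennreal \<bar>?f n x t\<bar>) \<in> borel_measurable (\<nu> \<Otimes>\<^sub>M lborel)"
      by measurable
  qed
  finally show "heat_mass \<alpha> \<nu> g \<le> liminf (\<lambda>n. heat_mass \<alpha> \<nu> (h n))"
    unfolding swap[OF m] .
qed

text \<open>The bound is stated with a real \<open>M\<close> above the limsup: from some index on, the coefficient sums
  are below \<open>M\<close>. Measurability of the heat extension of \<open>\<mu>\<close> comes from the atoms as well.\<close>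
lemma heat_mass_representation:
  fixes \<mu> :: "(real ^ 'd) set \<Rightarrow> real" and \<nu> :: "(real ^ 'd) measure"
  assumes \<nu>: "ball_growth C \<gamma> \<nu>" and K: "0 < K"
    and atoms: "\<And>a. is_atom \<beta> a \<Longrightarrow> heat_mass \<alpha> \<nu> (\<lambda>x t. heat t a x) \<le> ennreal K"
    and rep: "atomic_representation \<beta> \<mu> c a"
  shows "(\<lambda>(x, t). indicator {0<..} t *\<^sub>R (t powr (\<alpha> / 2 - 1) * heat t \<mu> x)) \<in> borel_measurable (\<nu> \<Otimes>\<^sub>M lborel)"
    and "coeff_size c < ereal M \<Longrightarrow> heat_mass \<alpha> \<nu> (\<lambda>x t. heat t \<mu> x) \<le> ennreal (K * M)"
proof -
  define h where "h = (\<lambda>n x t. \<Sum>i=1..n. c i n * heat t (a i n) x)"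
  have sets: "sets \<nu> = sets borel"
    using \<nu> by (simp add: ball_growth_def)
  have atom: "is_atom \<beta> (a i n)" if "i \<in> {1..n}" for i n
    using rep that by (simp add: atomic_representation_def)
  have ma: "(\<lambda>(x, t). heat t (a i n) x) \<in> borel_measurable (\<nu> \<Otimes>\<^sub>M lborel)" if "i \<in> {1..n}" for i n
  proof -
    have "total_variation (a i n) UNIV \<le> 1"
      using atom[OF that] by (auto simp: is_atom_def)
    then have "total_variation (a i n) UNIV < \<infinity>"
      by (rule order_le_less_trans) simp
    from measurable_heat[OF this] show ?thesis
      by (simp cong: measurable_cong_sets add: sets sets_pair_measure_cong[OF sets sets_lborel])
  qed
  have meas: "(\<lambda>(x, t). h n x t) \<in> borel_measurable (\<nu> \<Otimes>\<^sub>M lborel)" for n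
  proof -
    have "(\<lambda>p. \<Sum>i=1..n. c i n * (case p of (x, t) \<Rightarrow> heat t (a i n) x)) \<in> borel_measurable (\<nu> \<Otimes>\<^sub>M lborel)"
      by (intro borel_measurable_sum borel_measurable_times borel_measurable_const ma)
    then show ?thesis by (simp add: h_def split_beta')
  qed
  have lim: "(\<lambda>n. h n x t) \<longlonglongrightarrow> heat t \<mu> x" if "0 < t" for x t
    using rep continuous_heat_kernel[of t x] heat_kernel_tendsto_0[OF that, of x]
    unfolding h_def heat_eq_signed_integral atomic_representation_def by blast
  show "(\<lambda>(x, t). indicator {0<..} t *\<^sub>R (t powr (\<alpha> / 2 - 1) * heat t \<mu> x)) \<in> borel_measurable (\<nu> \<Otimes>\<^sub>M lborel)"
    by (rule heat_mass_limit(1)[OF meas lim])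
  assume M: "coeff_size c < ereal M"
  have bound: "heat_mass \<alpha> \<nu> (h n) \<le> ennreal (K * (\<Sum>i=1..n. \<bar>c i n\<bar>))" for n
  proof -
    have "heat_mass \<alpha> \<nu> (h n) \<le> (\<Sum>i=1..n. ennreal \<bar>c i n\<bar> * heat_mass \<alpha> \<nu> (\<lambda>x t. heat t (a i n) x))"
      unfolding h_def by (rule heat_mass_sum_le) (auto intro: ma)
    also have "\<dots> \<le> (\<Sum>i=1..n. ennreal \<bar>c i n\<bar> * ennreal K)"
      by (intro sum_mono mult_left_mono atoms atom) auto
    also have "\<dots> = ennreal (K * (\<Sum>i=1..n. \<bar>c i n\<bar>))"
      using K by (simp add: ennreal_mult[symmetric] sum_distrib_left mult.commute)
    finally show ?thesis .
  qed
  have "\<forall>\<^sub>F n in sequentially. ereal (\<Sum>i=1..n. \<bar>c i n\<bar>) < ereal M"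
    using M unfolding coeff_size_def by (rule Limsup_lessD)
  then have ev: "\<forall>\<^sub>F n in sequentially. heat_mass \<alpha> \<nu> (h n) \<le> ennreal (K * M)"
  proof eventually_elim
    case (elim n)
    then have "K * (\<Sum>i=1..n. \<bar>c i n\<bar>) \<le> K * M"
      using K by simp
    then show ?case
      using bound[of n] by (meson ennreal_leI order_trans)
  qed
  have "heat_mass \<alpha> \<nu> (\<lambda>x t. heat t \<mu> x) \<le> liminf (\<lambda>n. heat_mass \<alpha> \<nu> (h n))"
    by (rule heat_mass_limit(2)[OF meas lim])
  also have "\<dots> \<le> limsup (\<lambda>n. heat_mass \<alpha> \<nu> (h n))"
    by (intro Liminf_le_Limsup) simp
  also have "\<dots> \<le> ennreal (K * M)"
    using ev by (rule Limsup_bounded)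
  finally show "heat_mass \<alpha> \<nu> (\<lambda>x t. heat t \<mu> x) \<le> ennreal (K * M)" .
qed

section \<open>The trace inequality\<close>

lemma riesz_potential_of_heat_mass:
  fixes \<mu> :: "(real ^ 'd) set \<Rightarrow> real" and \<nu> :: "(real ^ 'd) measure"
  assumes \<alpha>: "0 < \<alpha>"
    and meas: "(\<lambda>(x, t). indicator {0<..} t *\<^sub>R (t powr (\<alpha> / 2 - 1) * heat t \<mu> x)) \<in> borel_measurable (\<nu> \<Otimes>\<^sub>M lborel)"
    and fin: "heat_mass \<alpha> \<nu> (\<lambda>x t. heat t \<mu> x) < \<infinity>"
  shows "AE x in \<nu>. riesz_converges \<alpha> \<mu> x"
    and "integrable \<nu> (riesz_potential \<alpha> \<mu>)"
    and "ennreal (LINT x|\<nu>. \<bar>riesz_potential \<alpha> \<mu> x\<bar>)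
      \<le> ennreal (1 / Gamma (\<alpha> / 2)) * heat_mass \<alpha> \<nu> (\<lambda>x t. heat t \<mu> x)"
proof -
  let ?f = "\<lambda>x t. indicator {0<..} t *\<^sub>R (t powr (\<alpha> / 2 - 1) * heat t \<mu> x)"
  have G: "0 < Gamma (\<alpha> / 2)" using \<alpha> by (intro Gamma_real_pos) simp
  have mt: "?f x \<in> borel_measurable lborel" if "x \<in> space \<nu>" for x
    using measurable_compose_Pair1[OF that meas] by simp
  note meas[measurable]
  have mN: "(\<lambda>x. \<integral>\<^sup>+t. ennreal \<bar>?f x t\<bar> \<partial>lborel) \<in> borel_measurable \<nu>"
    by (rule lborel.borel_measurable_nn_integral) measurable
  have "AE x in \<nu>. (\<integral>\<^sup>+t. ennreal \<bar>?f x t\<bar> \<partial>lborel) \<noteq> \<infinity>"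
    using fin unfolding heat_mass_def by (intro nn_integral_PInf_AE mN) auto
  then show "AE x in \<nu>. riesz_converges \<alpha> \<mu> x"
    using AE_space
  proof eventually_elim
    case (elim x)
    then show ?case
      unfolding riesz_converges_def set_integrable_def
      by (intro integrableI_bounded mt) (auto simp: less_top)
  qed
  have mR: "riesz_potential \<alpha> \<mu> \<in> borel_measurable \<nu>"
  proof -
    have "(\<lambda>x. LINT t|lborel. ?f x t) \<in> borel_measurable \<nu>"
      by (rule lborel.borel_measurable_lebesgue_integral) measurable
    then have "(\<lambda>x. 1 / Gamma (\<alpha> / 2) * (LINT t|lborel. ?f x t)) \<in> borel_measurable \<nu>"
      by (intro borel_measurable_times borel_measurable_const)
    then show ?thesis
      by (simp add: riesz_potential_def[abs_def] set_lebesgue_integral_def)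
  qed
  have pt: "ennreal \<bar>riesz_potential \<alpha> \<mu> x\<bar> \<le> ennreal (1 / Gamma (\<alpha> / 2)) * (\<integral>\<^sup>+t. ennreal \<bar>?f x t\<bar> \<partial>lborel)" for x
  proof (cases "integrable lborel (?f x)")
    case True
    have "ennreal \<bar>riesz_potential \<alpha> \<mu> x\<bar> = ennreal (1 / Gamma (\<alpha> / 2)) * ennreal \<bar>LINT t|lborel. ?f x t\<bar>"
      using G by (simp add: riesz_potential_def set_lebesgue_integral_def abs_mult ennreal_mult[symmetric])
    also have "\<dots> \<le> ennreal (1 / Gamma (\<alpha> / 2)) * (\<integral>\<^sup>+t. ennreal \<bar>?f x t\<bar> \<partial>lborel)"
      using integral_norm_bound_ennreal[OF True] by (intro mult_left_mono) auto
    finally show ?thesis .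
  next
    case False
    then show ?thesis
      by (simp add: riesz_potential_def set_lebesgue_integral_def not_integrable_integral_eq)
  qed
  have le: "(\<integral>\<^sup>+x. ennreal \<bar>riesz_potential \<alpha> \<mu> x\<bar> \<partial>\<nu>)
      \<le> ennreal (1 / Gamma (\<alpha> / 2)) * heat_mass \<alpha> \<nu> (\<lambda>x t. heat t \<mu> x)"
    unfolding heat_mass_def
    by (subst nn_integral_cmult[symmetric, OF mN]) (intro nn_integral_mono pt)
  also have "\<dots> < \<infinity>"
    using fin by (simp add: ennreal_mult_less_top)
  finally show int: "integrable \<nu> (riesz_potential \<alpha> \<mu>)"
    by (intro integrableI_bounded mR) simp
  have "(\<integral>\<^sup>+x. ennreal \<bar>riesz_potential \<alpha> \<mu> x\<bar> \<partial>\<nu>) = ennreal (LINT x|\<nu>. \<bar>riesz_potential \<alpha> \<mu> x\<bar>)"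
    using int by (intro nn_integral_eq_integral) auto
  with le show "ennreal (LINT x|\<nu>. \<bar>riesz_potential \<alpha> \<mu> x\<bar>)
      \<le> ennreal (1 / Gamma (\<alpha> / 2)) * heat_mass \<alpha> \<nu> (\<lambda>x t. heat t \<mu> x)"
    by simp
qed

lemma coeff_size_nonneg: "0 \<le> coeff_size c"
proof -
  have "0 \<le> liminf (\<lambda>n. ereal (\<Sum>i=1..n. \<bar>c i n\<bar>))"
    by (intro Liminf_bounded always_eventually allI) (simp add: sum_nonneg)
  also have "\<dots> \<le> coeff_size c"
    unfolding coeff_size_def by (intro Liminf_le_Limsup) simp
  finally show ?thesis .
qed

theorem theorem2:
  fixes \<alpha> \<beta> C' :: real
  assumes "0 < \<beta>" and "\<beta> \<le> real CARD('d::finite)"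
    and "real CARD('d) - \<beta> < \<alpha>" and "\<alpha> < real CARD('d)"
    and "C' > 0"
  shows "\<exists>C>0. \<forall>(\<nu> :: (real ^ 'd) measure) (\<mu> :: (real ^ 'd) set \<Rightarrow> real).
    radon_measure \<nu> \<longrightarrow>
    (\<forall>x r. r > 0 \<longrightarrow> emeasure \<nu> (ball x r) \<le> ennreal (C' * r powr (real CARD('d) - \<alpha>))) \<longrightarrow>
    \<mu> \<in> DS \<beta> \<longrightarrow>
      (AE x in \<nu>. riesz_converges \<alpha> \<mu> x) \<and>
      integrable \<nu> (riesz_potential \<alpha> \<mu>) \<and>
      ereal (LINT x|\<nu>. \<bar>riesz_potential \<alpha> \<mu> x\<bar>) \<le> ereal C * DS_norm \<beta> \<mu>"
proof -
  obtain K where K: "0 < K" and atoms: "\<And>(\<nu> :: (real ^ 'd) measure) a.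
      ball_growth C' (real CARD('d) - \<alpha>) \<nu> \<Longrightarrow> is_atom \<beta> a \<Longrightarrow>
      heat_mass \<alpha> \<nu> (\<lambda>x t. heat t a x) \<le> ennreal K"
    using heat_mass_atom_bounded[OF assms(3) \<open>C' > 0\<close>] by blast
  have \<alpha>: "0 < \<alpha>" using assms(2,3) by simp
  have G: "0 < Gamma (\<alpha> / 2)" using \<alpha> by (intro Gamma_real_pos) simp
  define C where "C = K / Gamma (\<alpha> / 2)"
  have C: "0 < C" using K G by (simp add: C_def)
  have "(AE x in \<nu>. riesz_converges \<alpha> \<mu> x) \<and> integrable \<nu> (riesz_potential \<alpha> \<mu>) \<and>
      ereal (LINT x|\<nu>. \<bar>riesz_potential \<alpha> \<mu> x\<bar>) \<le> ereal C * DS_norm \<beta> \<mu>"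
    if radon: "radon_measure \<nu>"
      and growth: "\<forall>x r. r > 0 \<longrightarrow> emeasure \<nu> (ball x r) \<le> ennreal (C' * r powr (real CARD('d) - \<alpha>))"
      and \<mu>: "\<mu> \<in> DS \<beta>" for \<nu> :: "(real ^ 'd) measure" and \<mu>
  proof -
    have \<nu>: "ball_growth C' (real CARD('d) - \<alpha>) \<nu>"
      using radon growth by (simp add: ball_growth_def radon_measure_def)
    define L where "L = (LINT x|\<nu>. \<bar>riesz_potential \<alpha> \<mu> x\<bar>)"
    have *: "(AE x in \<nu>. riesz_converges \<alpha> \<mu> x) \<and> integrable \<nu> (riesz_potential \<alpha> \<mu>) \<and> L \<le> C * M"
      if rep: "atomic_representation \<beta> \<mu> c a" and M: "coeff_size c < ereal M" for c a M
    proof -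
      have "ereal 0 < ereal M"
        using order_le_less_trans[OF coeff_size_nonneg M] by (simp add: zero_ereal_def)
      then have M0: "0 < M" by simp
      note meas = heat_mass_representation(1)[OF \<nu> K atoms[OF \<nu>] rep]
      have mass: "heat_mass \<alpha> \<nu> (\<lambda>x t. heat t \<mu> x) \<le> ennreal (K * M)"
        by (rule heat_mass_representation(2)[OF \<nu> K atoms[OF \<nu>] rep M])
      then have fin: "heat_mass \<alpha> \<nu> (\<lambda>x t. heat t \<mu> x) < \<infinity>"
        by (rule order_le_less_trans) simp
      note R = riesz_potential_of_heat_mass[OF \<alpha> meas fin]
      have "ennreal L \<le> ennreal (1 / Gamma (\<alpha> / 2)) * ennreal (K * M)"
        unfolding L_def using R(3) mass by (meson mult_left_mono order_trans zero_le)
      also have "\<dots> = ennreal (C * M)"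
        using G K M0 by (simp add: C_def ennreal_mult[symmetric])
      finally have "L \<le> C * M"
        using C M0 by (simp add: ennreal_le_iff)
      with R(1,2) show ?thesis by blast
    qed
    have le: "ereal (L / C) \<le> coeff_size c" if rep: "atomic_representation \<beta> \<mu> c a" for c a
    proof (rule ereal_le_real)
      fix M assume "coeff_size c \<le> ereal M"
      \<comment> \<open>The bound needs a strict inequality, hence the room \<open>e\<close>.\<close>
      have "L \<le> C * (M + e)" if "0 < e" for e
      proof -
        have "coeff_size c < ereal (M + e)"
          using \<open>coeff_size c \<le> ereal M\<close> that by (meson ereal_less_eq(3) less_add_same_cancel1 less_ereal.simps(1) order_le_less_trans)
        then show ?thesis using *[OF rep] by blast
      qed
      then have "L / C \<le> M + e" if "0 < e" for e
        using that C by (simp add: pos_divide_le_eq mult.commute)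
      then have "L / C \<le> M" by (rule field_le_epsilon)
      then show "ereal (L / C) \<le> ereal M" by simp
    qed
    have "ereal (L / C) \<le> DS_norm \<beta> \<mu>"
      unfolding DS_norm_def by (rule Inf_greatest) (use le in blast)
    then have "ereal C * ereal (L / C) \<le> ereal C * DS_norm \<beta> \<mu>"
      using C by (intro ereal_mult_left_mono) auto
    then have "ereal L \<le> ereal C * DS_norm \<beta> \<mu>"
      using C by simp
    moreover obtain c a where rep: "atomic_representation \<beta> \<mu> c a"
      using \<mu> by (auto simp: DS_def)
    moreover obtain M where "coeff_size c < ereal M"
      using rep less_PInf_Ex_of_nat[of "coeff_size c"] by (auto simp: atomic_representation_def)
    ultimately show ?thesis
      using * unfolding L_def by blast
  qed
  with C show ?thesis by blast
qed

end
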